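(* For $0\le k\le (n-1)/2$ we have \[ \gamma_{n,k}(q):=\sum_{\sigma\in \mathrm{DD}_{n,k}}q^{2(31\text{-}2)\sigma+(2\text{-}13)\sigma} =\sum_{\sigma\in \mathrm{DE}^*_{n,k}}q^{\mathsf{inv}\,\sigma-\mathsf{exc}\,\sigma} =\sum_{\sigma\in \mathrm{SDE}_{n,k}}q^{\mathsf{inv}\,\sigma-\mathsf{exc}\,\sigma}. \]
   Context: For $\sigma\in\mathfrak{S}_n$: $\mathsf{des}\,\sigma$ is the number of $i\in[n-1]$ with $\sigma(i)>\sigma(i+1)$; $\mathsf{exc}\,\sigma$ is the number of $i$ with $\sigma(i)>i$; $\mathsf{inv}\,\sigma$ is the number of inversions; with convention $\sigma(0)=\sigma(n+1)=0$, $\mathsf{dd}\,\sigma$ is the number of double descents, i.e. values $\sigma(i)$ ($1\le i\le n$) with $\sigma(i-1)>\sigma(i)>\sigma(i+1)$. The vincular pattern statistics are $(31\text{-}2)\sigma=\#\{(i,j): i+1<j\le n,\ \sigma(i+1)<\sigma(j)<\sigma(i)\}$ and $(2\text{-}13)\sigma=\#\{(i,j): j<i<n,\ \sigma(i)<\sigma(j)<\sigma(i+1)\}$. The star companion of $\sigma\in\mathfrak{S}_n$ is the permutation $\sigma^*$ of $\{0,1,\ldots,n\}$ with $\sigma^*(0)=n$ and $\sigma^*(i)=\sigma(i)-1$ for $i\in[n]$. Let $\mathsf{cda}^*\sigma=\#\{i\in[n-1]: (\sigma^* )^{-1}(i)<i<\sigma^*(i)\}$ and $\mathsf{fix}^*\sigma=\#\{i\in[n-1]: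 \sigma^*(i)=i\}$. Let $\mathsf{scda}\,\sigma=\#\{i\in[n-1]: i<\sigma(i)\ \text{and}\ i+1>\sigma^{-1}(i+1)\}$. Define $\mathrm{DD}_{n,k}=\{\sigma\in\mathfrak{S}_n:\mathsf{des}\,\sigma=k,\ \mathsf{dd}\,\sigma=0\}$, $\mathrm{DE}^*_{n,k}=\{\sigma\in\mathfrak{S}_n:\mathsf{exc}\,\sigma=k,\ \mathsf{cda}^*\sigma+\mathsf{fix}^*\sigma=0\}$, and $\mathrm{SDE}_{n,k}=\{\sigma\in\mathfrak{S}_n:\mathsf{exc}\,\sigma=k,\ \mathsf{scda}\,\sigma=0\}$. *)

theory Defs
  imports "HOL-Combinatorics.Permutations" "HOL-Computational_Algebra.Polynomial"
begin

definition perms :: "nat \<Rightarrow> (nat \<Rightarrow> nat) set" where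
  "perms n = {\<sigma>. \<sigma> permutes {1..n}}"

definition des :: "nat \<Rightarrow> (nat \<Rightarrow> nat) \<Rightarrow> nat" where
  "des n \<sigma> = card {i \<in> {1..n-1}. \<sigma> i > \<sigma> (Suc i)}"

definition exc :: "nat \<Rightarrow> (nat \<Rightarrow> nat) \<Rightarrow> nat" where
  "exc n \<sigma> = card {i \<in> {1..n}. \<sigma> i > i}"

definition inversions :: "nat \<Rightarrow> (nat \<Rightarrow> nat) \<Rightarrow> nat" where
  "inversions n \<sigma> = card {(i, j). 1 \<le> i \<and> i < j \<and> j \<le> n \<and> \<sigma> i > \<sigma> j}"

definition ext0 :: "nat \<Rightarrow> (nat \<Rightarrow> nat) \<Rightarrow> nat \<Rightarrow> nat" where
  "ext0 n \<sigma> i = (if i = 0 \<or> i = Suc n then 0 else \<sigma> i)"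

definition dd :: "nat \<Rightarrow> (nat \<Rightarrow> nat) \<Rightarrow> nat" where
  "dd n \<sigma> = card {i \<in> {1..n}. ext0 n \<sigma> (i - 1) > ext0 n \<sigma> i \<and> ext0 n \<sigma> i > ext0 n \<sigma> (Suc i)}"

definition pat31_2 :: "nat \<Rightarrow> (nat \<Rightarrow> nat) \<Rightarrow> nat" where
  "pat31_2 n \<sigma> = card {(i, j). 1 \<le> i \<and> i + 1 < j \<and> j \<le> n \<and>
      \<sigma> (Suc i) < \<sigma> j \<and> \<sigma> j < \<sigma> i}"

definition pat2_13 :: "nat \<Rightarrow> (nat \<Rightarrow> nat) \<Rightarrow> nat" where
  "pat2_13 n \<sigma> = card {(i, j). 1 \<le> j \<and> j < i \<and> i < n \<and>
      \<sigma> i < \<sigma> j \<and> \<sigma> j < \<sigma> (Suc i)}"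

definition star :: "nat \<Rightarrow> (nat \<Rightarrow> nat) \<Rightarrow> nat \<Rightarrow> nat" where
  "star n \<sigma> i = (if i = 0 then n else \<sigma> i - 1)"

definition cda_star :: "nat \<Rightarrow> (nat \<Rightarrow> nat) \<Rightarrow> nat" where
  "cda_star n \<sigma> = card {i \<in> {1..n-1}.
      inv_into {0..n} (star n \<sigma>) i < i \<and> i < star n \<sigma> i}"

definition fix_star :: "nat \<Rightarrow> (nat \<Rightarrow> nat) \<Rightarrow> nat" where
  "fix_star n \<sigma> = card {i \<in> {1..n-1}. star n \<sigma> i = i}"

definition scda :: "nat \<Rightarrow> (nat \<Rightarrow> nat) \<Rightarrow> nat" where
  "scda n \<sigma> = card {i \<in> {1..n-1}. i < \<sigma> i \<and> Suc i > inv_into {1..n} \<sigma> (Suc i)}"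

definition DD :: "nat \<Rightarrow> nat \<Rightarrow> (nat \<Rightarrow> nat) set" where
  "DD n k = {\<sigma> \<in> perms n. des n \<sigma> = k \<and> dd n \<sigma> = 0}"

definition DE_star :: "nat \<Rightarrow> nat \<Rightarrow> (nat \<Rightarrow> nat) set" where
  "DE_star n k = {\<sigma> \<in> perms n. exc n \<sigma> = k \<and> cda_star n \<sigma> + fix_star n \<sigma> = 0}"

definition SDE :: "nat \<Rightarrow> nat \<Rightarrow> (nat \<Rightarrow> nat) set" where
  "SDE n k = {\<sigma> \<in> perms n. exc n \<sigma> = k \<and> scda n \<sigma> = 0}"

end

theory Submission
  imports Defs
begin

text \<open>
  A permutation is coded in two ways by a labelled Motzkin path with \<open>n - 1\<close> steps.
  Scanning positions and values simultaneously, exceedances open and close arcs, and the numbers of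
  nestings as labels account for \<open>inv - exc\<close>. Inserting the letters \<open>1, 2, \<dots>\<close> of the word into the gaps
  between the smaller letters, the index of the gap is the number of occurrences of \<open>31-2\<close> in which
  the letter plays the role of \<open>2\<close>, and the remaining gaps count those of \<open>2-13\<close>.
  Both codings are injective, and there are exactly \<open>n!\<close> codes of either kind, so both are bijective.
  At height \<open>h\<close> the level steps carry the same weight \<open>q^h [h+1]\<close> in both cases, and a matching pair of an
  up step and a down step has the same total weight, so the weighted path sums agree. The indices
  counted by \<open>scda\<close> are the steps that open and close at once, as are the double descents.
\<close>

section \<open>Labelled Motzkin paths\<close>

text \<open>Natural subtraction leaves a pure down step at height 0 where it is. Both choice sets
  are empty there, so no history contains such a step.\<close>

fun next_height :: "nat \<Rightarrow> bool \<times> bool \<Rightarrow> nat" where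
  "next_height h (u, d) = h + of_bool u - of_bool d"

text \<open>A step is a pair (opens, closes). Histories have \<open>n - 1\<close> steps for a permutation
  of \<open>n\<close>, since the last letter is forced.\<close>

fun histories :: "(nat \<Rightarrow> bool \<times> bool \<Rightarrow> 'c set) \<Rightarrow> nat \<Rightarrow> nat \<Rightarrow> ((bool \<times> bool) \<times> 'c) list set" where
  "histories C 0 h = (if h = 0 then {[]} else {})"
| "histories C (Suc m) h =
    (\<lambda>(t, x, cs). (t, x) # cs) ` (SIGMA t:UNIV. SIGMA x:C h t. histories C m (next_height h t))"

fun history_weight :: "(nat \<Rightarrow> bool \<times> bool \<Rightarrow> 'c \<Rightarrow> 'a::comm_semiring_1) \<Rightarrow> nat
    \<Rightarrow> ((bool \<times> bool) \<times> 'c) list \<Rightarrow> 'a" where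
  "history_weight f h [] = 1"
| "history_weight f h ((t, x) # cs) = f h t x * history_weight f (next_height h t) cs"

text \<open>The weighted count of paths of \<open>m\<close> steps from height \<open>h\<close> to 0,
  where \<open>K h t\<close> is the total weight of the labels available to a step \<open>t\<close>
  at height \<open>h\<close>.\<close>

fun transfer :: "(nat \<Rightarrow> bool \<times> bool \<Rightarrow> 'a::comm_semiring_1) \<Rightarrow> nat \<Rightarrow> nat \<Rightarrow> 'a" where
  "transfer K 0 h = of_bool (h = 0)"
| "transfer K (Suc m) h = (\<Sum>t\<in>UNIV. K h t * transfer K m (next_height h t))"

lemma finite_histories:
  assumes "\<And>h t. finite (C h t)"
  shows "finite (histories C m h)"
  by (induction m arbitrary: h) (auto intro!: finite_imageI finite_SigmaI assms)

lemma sum_histories: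
  assumes "\<And>h t. finite (C h t)"
  shows "(\<Sum>cs\<in>histories C m h. history_weight f h cs)
    = transfer (\<lambda>h t. \<Sum>x\<in>C h t. f h t x) m h"
proof (induction m arbitrary: h)
  case (Suc m)
  have "(\<Sum>cs\<in>histories C (Suc m) h. history_weight f h cs)
      = (\<Sum>(t, x, cs)\<in>(SIGMA t:UNIV. SIGMA x:C h t. histories C m (next_height h t)).
          f h t x * history_weight f (next_height h t) cs)"
    unfolding histories.simps
    by (subst sum.reindex) (auto simp: inj_on_def case_prod_beta)
  also have "\<dots> = (\<Sum>t\<in>UNIV. \<Sum>x\<in>C h t. \<Sum>cs\<in>histories C m (next_height h t).
      f h t x * history_weight f (next_height h t) cs)"
    by (simp add: sum.Sigma assms finite_histories finite_SigmaI case_prod_beta)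
  also have "\<dots> = (\<Sum>t\<in>UNIV. (\<Sum>x\<in>C h t. f h t x) *
      transfer (\<lambda>h t. \<Sum>x\<in>C h t. f h t x) m (next_height h t))"
    by (simp add: Suc.IH[symmetric] sum_product)
  finally show ?case by simp
qed simp

lemma card_histories:
  assumes "\<And>h t. finite (C h t)"
  shows "card (histories C m h) = transfer (\<lambda>h t. card (C h t)) m h"
proof -
  have "history_weight (\<lambda>h t x. 1) h cs = (1::nat)" for h :: nat and cs :: "((bool \<times> bool) \<times> 'a) list"
    by (induction cs arbitrary: h) auto
  then show ?thesis
    using sum_histories[OF assms, where f = "\<lambda>h t x. 1::nat" and m = m and h = h] by simp
qed

text \<open>A potential \<open>P\<close> moves the choices of a down step to the matching up step,
  so only the product of the two matters.\<close>

lemma transfer_gauge: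
  assumes "\<And>h t. P h * K h t = K' h t * P (next_height h t)" and "P 0 = 1"
  shows "P h * transfer K m h = transfer K' m h"
proof (induction m arbitrary: h)
  case 0
  then show ?case using assms(2) by (auto simp: of_bool_def)
next
  case (Suc m)
  have "P h * transfer K (Suc m) h
      = (\<Sum>t\<in>UNIV. (P h * K h t) * transfer K m (next_height h t))"
    by (simp add: sum_distrib_left mult.assoc)
  also have "\<dots> = (\<Sum>t\<in>UNIV. K' h t * transfer K' m (next_height h t))"
    by (simp only: assms(1) mult.assoc Suc.IH)
  finally show ?case by simp
qed

lemma map_upt_in_histories:
  assumes "i \<le> n"
    and "\<And>j. i \<le> j \<Longrightarrow> j < n \<Longrightarrow> x j \<in> C (h j) (t j) \<and> h (Suc j) = next_height (h j) (t j)"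
    and "h n = 0"
  shows "map (\<lambda>j. (t j, x j)) [i..<n] \<in> histories C (n - i) (h i)"
    and "history_weight f (h i) (map (\<lambda>j. (t j, x j)) [i..<n]) = (\<Prod>j=i..<n. f (h j) (t j) (x j))"
proof -
  have "map (\<lambda>j. (t j, x j)) [i..<n] \<in> histories C (n - i) (h i) \<and>
    history_weight f (h i) (map (\<lambda>j. (t j, x j)) [i..<n]) = (\<Prod>j=i..<n. f (h j) (t j) (x j))"
    using assms(1,2)
  proof (induction i rule: inc_induct)
    case base
    then show ?case using assms(3) by simp
  next
    case (step i)
    then have "n - i = Suc (n - Suc i)" by simp
    moreover have "[i..<n] = i # [Suc i..<n]" "{i..<n} = insert i {Suc i..<n}"
      using step by (auto simp: upt_conv_Cons)
    moreover have "x i \<in> C (h i) (t i)" "h (Suc i) = next_height (h i) (t i)"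
      using step by auto
    ultimately show ?case using step
      by (auto simp del: upt_Suc intro!: image_eqI[where x = "(t i, x i, map (\<lambda>j. (t j, x j)) [Suc i..<n])"])
  qed
  then show "map (\<lambda>j. (t j, x j)) [i..<n] \<in> histories C (n - i) (h i)"
    "history_weight f (h i) (map (\<lambda>j. (t j, x j)) [i..<n]) = (\<Prod>j=i..<n. f (h j) (t j) (x j))"
    by auto
qed

lemma card_perms: "card (perms n) = fact n" and finite_perms: "finite (perms n)"
  unfolding perms_def using card_permutations[of "{1..n}" n] by (auto intro: finite_permutations)

text \<open>Surjectivity of the coding \<open>(t, x)\<close> is obtained from injectivity by counting histories.\<close>

lemma sum_perms_eq_transfer:
  assumes fin: "\<And>h t. finite (C h t)" and n: "1 \<le> n"
    and hist: "\<And>\<sigma> j. \<sigma> \<in> perms n \<Longrightarrow> 1 \<le> j \<Longrightarrow> j < n \<Longrightarrow>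
      x \<sigma> j \<in> C (h \<sigma> j) (t \<sigma> j) \<and> h \<sigma> (Suc j) = next_height (h \<sigma> j) (t \<sigma> j)"
    and ends: "\<And>\<sigma>. \<sigma> \<in> perms n \<Longrightarrow> h \<sigma> 1 = 0" "\<And>\<sigma>. \<sigma> \<in> perms n \<Longrightarrow> h \<sigma> n = 0"
    and inj: "\<And>\<sigma> \<tau>. \<sigma> \<in> perms n \<Longrightarrow> \<tau> \<in> perms n \<Longrightarrow>
      (\<And>j. 1 \<le> j \<Longrightarrow> j < n \<Longrightarrow> t \<sigma> j = t \<tau> j \<and> x \<sigma> j = x \<tau> j) \<Longrightarrow> \<sigma> = \<tau>"
    and count: "transfer (\<lambda>h t. card (C h t)) (n - 1) 0 = fact n"
  shows "(\<Sum>\<sigma>\<in>perms n. \<Prod>j=1..<n. f (h \<sigma> j) (t \<sigma> j) (x \<sigma> j))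
    = transfer (\<lambda>h t. \<Sum>x\<in>C h t. f h t x) (n - 1) 0"
proof -
  define code where "code \<sigma> = map (\<lambda>j. (t \<sigma> j, x \<sigma> j)) [1..<n]" for \<sigma>
  have mem: "code \<sigma> \<in> histories C (n - 1) 0"
    and wt: "history_weight f 0 (code \<sigma>) = (\<Prod>j=1..<n. f (h \<sigma> j) (t \<sigma> j) (x \<sigma> j))"
    if "\<sigma> \<in> perms n" for \<sigma>
    using map_upt_in_histories[OF n, of "x \<sigma>" C "h \<sigma>" "t \<sigma>"] hist[OF that] ends[OF that]
    unfolding code_def by auto
  have inj': "inj_on code (perms n)"
    unfolding code_def by (rule inj_onI) (auto intro!: inj)
  \<comment> \<open>An injective image of \<open>fact n\<close> elements inside a finite set of
    \<open>fact n\<close> histories is the whole set.\<close>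
  have "code ` perms n = histories C (n - 1) 0"
    using mem card_image[OF inj'] count
    by (intro card_subset_eq) (auto simp: card_perms card_histories[OF fin] intro!: finite_histories fin)
  then show ?thesis
    using sum.reindex[OF inj', of "history_weight f 0"] wt
    by (simp add: sum_histories[OF fin])
qed

section \<open>Permutations of \<open>{1..n}\<close>, their inverses and the crossings of a
  level\<close>

context
  fixes n :: nat and \<sigma> :: "nat \<Rightarrow> nat"
  assumes \<sigma>: "\<sigma> \<in> perms n"
begin

lemma perms_permutes: "\<sigma> permutes {1..n}"
  using \<sigma> by (simp add: perms_def)

lemma perm_eq_iff: "\<sigma> i = \<sigma> j \<longleftrightarrow> i = j"
  using permutes_inj[OF perms_permutes] by (auto simp: inj_def)

lemma inv_eq_iff: "inv \<sigma> v = i \<longleftrightarrow> \<sigma> i = v"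
  using permutes_inverses[OF perms_permutes] by auto

lemma perm_inv: "\<sigma> (inv \<sigma> v) = v"
  using permutes_inverses[OF perms_permutes] by auto

lemma inv_perm: "inv \<sigma> (\<sigma> i) = i"
  using permutes_inverses[OF perms_permutes] by auto

lemma perm_range: "1 \<le> \<sigma> i \<and> \<sigma> i \<le> n \<longleftrightarrow> 1 \<le> i \<and> i \<le> n"
  using permutes_in_image[OF perms_permutes, of i] by auto

lemma inv_range: "1 \<le> inv \<sigma> v \<and> inv \<sigma> v \<le> n \<longleftrightarrow> 1 \<le> v \<and> v \<le> n"
  using perm_range[of "inv \<sigma> v"] by (simp add: perm_inv)

lemma perm_outside: "i = 0 \<or> n < i \<Longrightarrow> \<sigma> i = i"
  using permutes_not_in[OF perms_permutes, of i] by auto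

lemma perm_zero: "\<sigma> 0 = 0"
  using perm_outside by simp

lemma inv_into_eq_inv:
  assumes "1 \<le> v" "v \<le> n"
  shows "inv_into {1..n} \<sigma> v = inv \<sigma> v"
proof (rule inv_into_f_eq)
  show "inj_on \<sigma> {1..n}" using perm_eq_iff by (auto simp: inj_on_def)
  show "inv \<sigma> v \<in> {1..n}" using inv_range assms by auto
qed (rule perm_inv)

text \<open>\<sigma> maps the positions with value below \<open>v\<close> bijectively onto the
  positions below \<open>v\<close>; removing the common part of both sets leaves the two
  sides.\<close>

lemma card_crossing_level:
  "card {j \<in> {1..n}. v \<le> j \<and> \<sigma> j < v} = card {j \<in> {1..n}. j < v \<and> v \<le> \<sigma> j}"
proof -
  have "bij_betw \<sigma> {j \<in> {1..n}. \<sigma> j < v} {j \<in> {1..n}. j < v}"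
    by (rule bij_betwI[where g = "inv \<sigma>"]) (use perm_range inv_range in \<open>auto simp: perm_inv inv_perm\<close>)
  then have "card {j \<in> {1..n}. \<sigma> j < v} = card {j \<in> {1..n}. j < v}"
    by (rule bij_betw_same_card)
  moreover have "{j \<in> {1..n}. \<sigma> j < v} =
      {j \<in> {1..n}. v \<le> j \<and> \<sigma> j < v} \<union> {j \<in> {1..n}. j < v \<and> \<sigma> j < v}" by auto
  moreover have "{j \<in> {1..n}. j < v} =
      {j \<in> {1..n}. j < v \<and> v \<le> \<sigma> j} \<union> {j \<in> {1..n}. j < v \<and> \<sigma> j < v}" by auto
  moreover have "card ({j \<in> {1..n}. v \<le> j \<and> \<sigma> j < v} \<union> {j \<in> {1..n}. j < v \<and> \<sigma> j < v})
      = card {j \<in> {1..n}. v \<le> j \<and> \<sigma> j < v} + card {j \<in> {1..n}. j < v \<and> \<sigma> j < v}"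
    by (rule card_Un_disjoint) auto
  moreover have "card ({j \<in> {1..n}. j < v \<and> v \<le> \<sigma> j} \<union> {j \<in> {1..n}. j < v \<and> \<sigma> j < v})
      = card {j \<in> {1..n}. j < v \<and> v \<le> \<sigma> j} + card {j \<in> {1..n}. j < v \<and> \<sigma> j < v}"
    by (rule card_Un_disjoint) auto
  ultimately show ?thesis by simp
qed

end

lemma card_less_Suc: "card {i. i < Suc m \<and> P i} = card {i. i < m \<and> P i} + of_bool (P m)"
proof -
  have "{i. i < Suc m \<and> P i} = (if P m then insert m {i. i < m \<and> P i} else {i. i < m \<and> P i})"
    by (auto simp: less_Suc_eq)
  then show ?thesis by simp
qed

lemma perms_eqI:
  assumes "\<sigma> \<in> perms n" "\<tau> \<in> perms n" "\<And>i. 1 \<le> i \<Longrightarrow> i \<le> n \<Longrightarrow> \<sigma> i = \<tau> i"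
  shows "\<sigma> = \<tau>"
proof
  fix i
  show "\<sigma> i = \<tau> i"
    using assms(3)[of i] perm_outside[OF assms(1), of i] perm_outside[OF assms(2), of i]
    by (cases "1 \<le> i \<and> i \<le> n") auto
qed

section \<open>Coding by exceedances\<close>

text \<open>Step \<open>i\<close> treats position \<open>i\<close> together with value \<open>i + 1\<close>; the height is the number of positions
  before \<open>i\<close> that still wait for a value above \<open>i\<close>.\<close>

definition exc_height :: "(nat \<Rightarrow> nat) \<Rightarrow> nat \<Rightarrow> nat" where
  "exc_height \<sigma> i = card {p. p < i \<and> i < \<sigma> p}"

text \<open>An arc joins a position to its value. As value \<open>i + 1\<close> is read together
  with position \<open>i\<close>, an arc with \<open>\<sigma> i = i + 1\<close> opens and closes in
  one step; hence \<open>\<le>\<close> in the second component.\<close>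

definition exc_type :: "(nat \<Rightarrow> nat) \<Rightarrow> nat \<Rightarrow> bool \<times> bool" where
  "exc_type \<sigma> i = (i < \<sigma> i, inv \<sigma> (Suc i) \<le> i)"

text \<open>If \<open>\<sigma> i \<le> i\<close>, these \<open>j\<close> are the arcs below the
  diagonal that enclose the arc of \<open>i\<close>. \<open>nest_val\<close> does the same for
  exceedance arcs, indexed by the value.\<close>

definition nest_pos :: "(nat \<Rightarrow> nat) \<Rightarrow> nat \<Rightarrow> nat" where
  "nest_pos \<sigma> i = card {j. i < j \<and> \<sigma> j < \<sigma> i}"

definition nest_val :: "(nat \<Rightarrow> nat) \<Rightarrow> nat \<Rightarrow> nat" where
  "nest_val \<sigma> v = card {p. p < inv \<sigma> v \<and> v < \<sigma> p}"

definition exc_label :: "(nat \<Rightarrow> nat) \<Rightarrow> nat \<Rightarrow> nat \<times> nat" where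
  "exc_label \<sigma> i = (if i < \<sigma> i then 0 else nest_pos \<sigma> i,
     if inv \<sigma> (Suc i) \<le> i then nest_val \<sigma> (Suc i) else 0)"

text \<open>A closing step selects one of the open arcs, including one opened at the same step. The
  set \<open>{0}\<close> stands for a component without a choice.\<close>

fun exc_choices :: "nat \<Rightarrow> bool \<times> bool \<Rightarrow> (nat \<times> nat) set" where
  "exc_choices h (u, d) = (if u then {0} else {..h}) \<times> (if d then {..<h + of_bool u} else {0})"

text \<open>Nestings plus a height: the current height for a non-exceedance, and the height after
  the step, \<open>h + of_bool u - 1\<close>, for an exceedance that closes.\<close>

fun exc_weight :: "nat \<Rightarrow> bool \<times> bool \<Rightarrow> nat \<times> nat \<Rightarrow> nat" where
  "exc_weight h (u, d) (r, r') =
     (if u then 0 else h + r) + (if d then r' + (h + of_bool u - 1) else 0)"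

lemma finite_exc_choices: "finite (exc_choices h t)"
  by (cases t) auto

context
  fixes n :: nat and \<sigma> :: "nat \<Rightarrow> nat"
  assumes \<sigma>: "\<sigma> \<in> perms n"
begin

lemma card_open_positions:
  "card {p. p < Suc i \<and> i < \<sigma> p} = exc_height \<sigma> i + of_bool (i < \<sigma> i)"
  unfolding exc_height_def using card_less_Suc[of i "\<lambda>p. i < \<sigma> p"] by simp

text \<open>The positions up to \<open>i\<close> with value above \<open>i\<close> are split by
  whether the value is \<open>i + 1\<close>. The additive form avoids truncated subtraction.\<close>

lemma exc_height_Suc':
  "exc_height \<sigma> (Suc i) + of_bool (inv \<sigma> (Suc i) \<le> i) = exc_height \<sigma> i + of_bool (i < \<sigma> i)"
proof -
  have "i < \<sigma> p \<longleftrightarrow> Suc i < \<sigma> p \<or> p = inv \<sigma> (Suc i)" for p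
    using inv_eq_iff[OF \<sigma>, of "Suc i" p] by auto
  then have "{p. p < Suc i \<and> i < \<sigma> p} = {p. p < Suc i \<and> Suc i < \<sigma> p} \<union>
      (if inv \<sigma> (Suc i) \<le> i then {inv \<sigma> (Suc i)} else {})"
    by auto
  moreover have "card ({p. p < Suc i \<and> Suc i < \<sigma> p} \<union> (if inv \<sigma> (Suc i) \<le> i then {inv \<sigma> (Suc i)} else {}))
    = exc_height \<sigma> (Suc i) + of_bool (inv \<sigma> (Suc i) \<le> i)"
    unfolding exc_height_def using perm_inv[OF \<sigma>, of "Suc i"] by (subst card_Un_disjoint) auto
  ultimately show ?thesis using card_open_positions[of i] by simp
qed

lemma exc_height_Suc: "exc_height \<sigma> (Suc i) = next_height (exc_height \<sigma> i) (exc_type \<sigma> i)"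
  unfolding exc_type_def next_height.simps using exc_height_Suc'[of i] by linarith

lemma exc_height_1: "exc_height \<sigma> 1 = 0"
  unfolding exc_height_def using perm_zero[OF \<sigma>] by (auto simp: card_eq_0_iff)

lemma exc_height_n: "exc_height \<sigma> n = 0"
proof -
  have "\<sigma> p \<le> n" if "p < n" for p
    using that perm_range[OF \<sigma>, of p] perm_zero[OF \<sigma>] by (cases "p = 0") auto
  then have "{p. p < n \<and> n < \<sigma> p} = {}" by force
  then show ?thesis by (simp add: exc_height_def)
qed

text \<open>The positions after \<open>i\<close> with value at most \<open>i\<close> are as many as
  the positions up to \<open>i\<close> with value above \<open>i\<close>, and \<open>i\<close>
  itself is not one of the latter.\<close>

lemma nest_pos_le:
  assumes "1 \<le> i" "\<sigma> i \<le> i"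
  shows "nest_pos \<sigma> i \<le> exc_height \<sigma> i"
proof -
  have "nest_pos \<sigma> i \<le> card {j \<in> {1..n}. Suc i \<le> j \<and> \<sigma> j < Suc i}"
    unfolding nest_pos_def
  proof (rule card_mono)
    have "j \<le> n" if "i < j" "\<sigma> j < \<sigma> i" for j
      using that assms perm_outside[OF \<sigma>, of j] by linarith
    then show "{j. i < j \<and> \<sigma> j < \<sigma> i} \<subseteq> {j \<in> {1..n}. Suc i \<le> j \<and> \<sigma> j < Suc i}"
      using assms by auto
  qed auto
  also have "\<dots> = card {j \<in> {1..n}. j < Suc i \<and> Suc i \<le> \<sigma> j}"
    by (rule card_crossing_level[OF \<sigma>])
  also have "\<dots> \<le> exc_height \<sigma> i"
    unfolding exc_height_def
    by (rule card_mono) (use assms in \<open>auto simp: less_Suc_eq\<close>)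
  finally show ?thesis .
qed

text \<open>The position of value \<open>i + 1\<close> is open but does not enclose itself, so the
  inclusion is strict.\<close>

lemma nest_val_less:
  assumes "inv \<sigma> (Suc i) \<le> i"
  shows "nest_val \<sigma> (Suc i) < exc_height \<sigma> i + of_bool (i < \<sigma> i)"
  unfolding nest_val_def card_open_positions[symmetric]
proof (rule psubset_card_mono)
  have "inv \<sigma> (Suc i) \<in> {p. p < Suc i \<and> i < \<sigma> p}"
    using assms perm_inv[OF \<sigma>, of "Suc i"] by simp
  moreover have "{p. p < inv \<sigma> (Suc i) \<and> Suc i < \<sigma> p} \<subseteq> {p. p < Suc i \<and> i < \<sigma> p}"
    using assms by auto
  ultimately show "{p. p < inv \<sigma> (Suc i) \<and> Suc i < \<sigma> p} \<subset> {p. p < Suc i \<and> i < \<sigma> p}"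
    by blast
qed auto

lemma exc_label_mem:
  assumes "1 \<le> i"
  shows "exc_label \<sigma> i \<in> exc_choices (exc_height \<sigma> i) (exc_type \<sigma> i)"
  using nest_pos_le[OF assms] nest_val_less[of i]
  by (auto simp: exc_label_def exc_type_def)

end

section \<open>Injectivity of the exceedance coding\<close>

lemma nest_pos_strict:
  assumes \<sigma>: "\<sigma> \<in> perms n" and \<tau>: "\<tau> \<in> perms n"
    and val: "\<And>v. inv \<sigma> v < v \<longleftrightarrow> inv \<tau> v < v"
    and IH: "\<And>j. j < i \<Longrightarrow> \<tau> j \<le> j \<Longrightarrow> \<sigma> j = \<tau> j"
    and "\<sigma> i < \<tau> i" "\<tau> i \<le> i"
  shows "nest_pos \<sigma> i < nest_pos \<tau> i"
proof -
  have eq: "nest_pos \<rho> i = card {v. v < \<rho> i \<and> i < inv \<rho> v}" if "\<rho> \<in> perms n" for \<rho>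
    unfolding nest_pos_def
    by (rule bij_betw_same_card[of \<rho>], rule bij_betwI[where g = "inv \<rho>"])
      (auto simp: perm_inv[OF that] inv_perm[OF that])
  \<comment> \<open>If \<sigma> leaves \<open>v < \<tau> i\<close> for position \<open>i\<close> or
    later, then \<open>v\<close> is a non-exceedance value of \<sigma>, hence of \<tau>. By
    \<open>IH\<close>, \<tau> cannot have placed it before \<open>i\<close>.\<close>
  have late: "i < inv \<tau> v" if v: "v < \<tau> i" "i \<le> inv \<sigma> v" for v
  proof (rule ccontr)
    assume "\<not> i < inv \<tau> v"
    moreover have "v \<le> inv \<tau> v" using val[of v] v assms(6) by linarith
    moreover have "inv \<tau> v \<noteq> i" using v perm_inv[OF \<tau>, of v] by auto
    ultimately have "\<sigma> (inv \<tau> v) = v" and "inv \<tau> v < i"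
      using IH[of "inv \<tau> v"] perm_inv[OF \<tau>, of v] by auto
    then show False using inv_eq_iff[OF \<sigma>, of v "inv \<tau> v"] v by simp
  qed
  have "{v. v < \<sigma> i \<and> i < inv \<sigma> v} \<subset> {v. v < \<tau> i \<and> i < inv \<tau> v}"
  proof (rule psubsetI)
    show "{v. v < \<sigma> i \<and> i < inv \<sigma> v} \<subseteq> {v. v < \<tau> i \<and> i < inv \<tau> v}"
      using late assms(5) by fastforce
    have "\<sigma> i \<in> {v. v < \<tau> i \<and> i < inv \<tau> v}"
      using late[of "\<sigma> i"] assms(5) inv_perm[OF \<sigma>] by simp
    then show "{v. v < \<sigma> i \<and> i < inv \<sigma> v} \<noteq> {v. v < \<tau> i \<and> i < inv \<tau> v}" by blast
  qed
  then show ?thesis unfolding eq[OF \<sigma>] eq[OF \<tau>] by (intro psubset_card_mono) auto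
qed

text \<open>The mirror image of \<open>nest_pos_strict\<close>: positions and values are exchanged,
  and exceedances replace non-exceedances.\<close>

lemma nest_val_strict:
  assumes \<sigma>: "\<sigma> \<in> perms n" and \<tau>: "\<tau> \<in> perms n"
    and pos: "\<And>i. i < \<sigma> i \<longleftrightarrow> i < \<tau> i"
    and IH: "\<And>w. w < v \<Longrightarrow> inv \<tau> w < w \<Longrightarrow> inv \<sigma> w = inv \<tau> w"
    and "inv \<sigma> v < inv \<tau> v" "inv \<tau> v < v"
  shows "nest_val \<sigma> v < nest_val \<tau> v"
proof -
  have high: "v < \<tau> p" if p: "p < inv \<tau> v" "v \<le> \<sigma> p" for p
  proof (rule ccontr)
    assume "\<not> v < \<tau> p"
    moreover have "p < \<tau> p" using pos[of p] p assms(6) by linarith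
    moreover have "\<tau> p \<noteq> v" using p inv_perm[OF \<tau>, of p] by auto
    ultimately have "inv \<sigma> (\<tau> p) = p" and "\<tau> p < v"
      using IH[of "\<tau> p"] inv_perm[OF \<tau>, of p] by auto
    then show False using inv_eq_iff[OF \<sigma>, of "\<tau> p" p] p by simp
  qed
  have "{p. p < inv \<sigma> v \<and> v < \<sigma> p} \<subset> {p. p < inv \<tau> v \<and> v < \<tau> p}"
  proof (rule psubsetI)
    show "{p. p < inv \<sigma> v \<and> v < \<sigma> p} \<subseteq> {p. p < inv \<tau> v \<and> v < \<tau> p}"
      using high assms(5) by fastforce
    have "inv \<sigma> v \<in> {p. p < inv \<tau> v \<and> v < \<tau> p}"
      using high[of "inv \<sigma> v"] assms(5) perm_inv[OF \<sigma>] by simp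
    then show "{p. p < inv \<sigma> v \<and> v < \<sigma> p} \<noteq> {p. p < inv \<tau> v \<and> v < \<tau> p}" by blast
  qed
  then show ?thesis unfolding nest_val_def by (intro psubset_card_mono) auto
qed

text \<open>The types reveal the exceedance positions and the exceedance values. The labels then fix
  the non-exceedances from left to right and the exceedances by increasing value, since a smaller
  entry would have a strictly smaller label.\<close>

lemma exc_code_inj:
  assumes \<sigma>: "\<sigma> \<in> perms n" and \<tau>: "\<tau> \<in> perms n"
    and code: "\<And>j. 1 \<le> j \<Longrightarrow> j < n \<Longrightarrow> exc_type \<sigma> j = exc_type \<tau> j \<and> exc_label \<sigma> j = exc_label \<tau> j"
  shows "\<sigma> = \<tau>"
proof -
  \<comment> \<open>The code covers only the indices 1 to \<open>n - 1\<close>; at the others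
    nothing opens or closes, and from \<open>n\<close> on a non-exceedance has no nestings.\<close>
  have last: "\<not> i < \<rho> i" "\<not> inv \<rho> (Suc i) < Suc i" "\<rho> i \<le> i \<Longrightarrow> 1 \<le> i \<Longrightarrow> nest_pos \<rho> i = 0"
    if "\<rho> \<in> perms n" "i = 0 \<or> n \<le> i" for \<rho> i
  proof -
    note out = perm_outside[OF that(1)]
    have "\<rho> i = i" if "i \<noteq> n" using \<open>i = 0 \<or> n \<le> i\<close> that out[of i] by auto
    moreover have "\<rho> n \<le> n" using perm_range[OF that(1), of n] out[of n] by (cases "n = 0") auto
    ultimately show "\<not> i < \<rho> i" by (cases "i = n") auto
    show "\<not> inv \<rho> (Suc i) < Suc i"
    proof (cases "i = 0")
      case True
      then show ?thesis using perm_inv[OF that(1), of "Suc i"] perm_zero[OF that(1)] by (metis less_Suc0 nat.distinct(1))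
    next
      case False
      then have "\<rho> (Suc i) = Suc i" using that(2) out[of "Suc i"] by simp
      then show ?thesis using inv_perm[OF that(1), of "Suc i"] by simp
    qed
    have "\<not> \<rho> j < \<rho> i" if "\<rho> i \<le> i" "1 \<le> i" "i < j" for j
      using that \<open>i = 0 \<or> n \<le> i\<close> out[of j] by auto
    then show "nest_pos \<rho> i = 0" if "\<rho> i \<le> i" "1 \<le> i"
      using that by (simp add: nest_pos_def card_eq_0_iff)
  qed
  have pos: "i < \<sigma> i \<longleftrightarrow> i < \<tau> i" for i
    using code[of i] last(1)[OF \<sigma>, of i] last(1)[OF \<tau>, of i]
    by (cases "1 \<le> i \<and> i < n") (auto simp: exc_type_def)
  have val: "inv \<sigma> v < v \<longleftrightarrow> inv \<tau> v < v" for v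
  proof (cases v)
    case (Suc i)
    then show ?thesis using code[of i] last(2)[OF \<sigma>, of i] last(2)[OF \<tau>, of i]
      by (cases "1 \<le> i \<and> i < n") (auto simp: exc_type_def less_Suc_eq_le)
  qed simp
  have nest_pos: "nest_pos \<sigma> i = nest_pos \<tau> i" if "1 \<le> i" "\<sigma> i \<le> i" for i
    using code[of i] last(3)[OF \<sigma>, of i] last(3)[OF \<tau>, of i] that pos[of i]
    by (cases "i < n") (auto simp: exc_label_def)
  have nest_val: "nest_val \<sigma> v = nest_val \<tau> v" if "inv \<sigma> v < v" for v
  proof (cases v)
    case (Suc i)
    then show ?thesis using code[of i] last(2)[OF \<sigma>, of i] that val[of v]
      by (cases "1 \<le> i \<and> i < n") (auto simp: exc_label_def less_Suc_eq_le)
  qed (use that in simp)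
  have nonexc: "\<sigma> i = \<tau> i" if "\<sigma> i \<le> i" for i
    using that
  proof (induction i rule: less_induct)
    case (less i)
    show ?case
    proof (cases "i = 0")
      case False
      have i: "\<tau> i \<le> i" "nest_pos \<sigma> i = nest_pos \<tau> i"
        using pos[of i] nest_pos[of i] less.prems False by auto
      have IH: "\<sigma> j = \<tau> j" if "j < i" "\<tau> j \<le> j" for j
        using less.IH[of j] pos[of j] that by linarith
      have IH': "\<tau> j = \<sigma> j" if "j < i" "\<sigma> j \<le> j" for j
        using less.IH[of j] that by simp
      have "\<not> \<sigma> i < \<tau> i"
        using nest_pos_strict[OF \<sigma> \<tau> val IH, of i] i by auto
      moreover have "\<not> \<tau> i < \<sigma> i"
        using nest_pos_strict[OF \<tau> \<sigma> val[symmetric] IH', of i] i less.prems by auto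
      ultimately show ?thesis by simp
    qed (simp add: perm_zero[OF \<sigma>] perm_zero[OF \<tau>])
  qed
  have exc: "inv \<sigma> v = inv \<tau> v" if "inv \<sigma> v < v" for v
    using that
  proof (induction v rule: less_induct)
    case (less v)
    have v: "inv \<tau> v < v" "nest_val \<sigma> v = nest_val \<tau> v"
      using val[of v] nest_val[of v] less.prems by auto
    have IH: "inv \<sigma> w = inv \<tau> w" if "w < v" "inv \<tau> w < w" for w
      using less.IH[of w] val[of w] that by linarith
    have IH': "inv \<tau> w = inv \<sigma> w" if "w < v" "inv \<sigma> w < w" for w
      using less.IH[of w] that by simp
    have "\<not> inv \<sigma> v < inv \<tau> v"
      using nest_val_strict[OF \<sigma> \<tau> pos IH, of v] v by auto
    moreover have "\<not> inv \<tau> v < inv \<sigma> v"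
      using nest_val_strict[OF \<tau> \<sigma> pos[symmetric] IH', of v] v less.prems by auto
    ultimately show ?case by simp
  qed
  show ?thesis
  proof
    fix i
    show "\<sigma> i = \<tau> i"
    proof (cases "\<sigma> i \<le> i")
      case False
      then have "inv \<tau> (\<sigma> i) = i" using exc[of "\<sigma> i"] inv_perm[OF \<sigma>, of i] by simp
      then show ?thesis using inv_eq_iff[OF \<tau>, of "\<sigma> i" i] by simp
    qed (rule nonexc)
  qed
qed

section \<open>Inversions as a sum over steps, and the double steps counted by
  \<open>scda\<close>\<close>

lemma card_filter_eq_0_iff: "finite A \<Longrightarrow> card {i \<in> A. P i} = 0 \<longleftrightarrow> (\<forall>i\<in>A. \<not> P i)"
  by auto

lemma card_pairs:
  fixes P :: "nat \<Rightarrow> nat \<Rightarrow> bool"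
  assumes "\<And>i j. P i j \<Longrightarrow> 1 \<le> i \<and> i \<le> n \<and> 1 \<le> j \<and> j \<le> n"
  shows "card {(i, j). P i j} = (\<Sum>i=1..n. \<Sum>j=1..n. of_bool (P i j))"
proof -
  have "{(i, j). P i j} = (SIGMA i:{1..n}. {j \<in> {1..n}. P i j})"
    using assms by auto
  then have "card {(i, j). P i j} = (\<Sum>i=1..n. card {j \<in> {1..n}. P i j})"
    by (simp add: card_SigmaI)
  also have "\<dots> = (\<Sum>i=1..n. \<Sum>j=1..n. of_bool (P i j))"
    by (intro sum.cong refl) (simp add: Int_def)
  finally show ?thesis .
qed

lemma sum_of_bool_conj:
  "(\<Sum>i\<in>A. of_bool (Q \<and> P i)) = (if Q then (\<Sum>i\<in>A. of_bool (P i)) else (0::nat))"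
  by simp

lemma sum_of_bool_card:
  assumes "finite A" "\<And>i. P i \<Longrightarrow> i \<in> A"
  shows "(\<Sum>i\<in>A. of_bool (P i)) = card {i. P i}"
proof -
  have "A \<inter> {i. P i} = {i. P i}" using assms(2) by auto
  then show ?thesis using assms(1) by simp
qed

context
  fixes n :: nat and \<sigma> :: "nat \<Rightarrow> nat"
  assumes \<sigma>: "\<sigma> \<in> perms n"
begin

text \<open>At level \<open>\<sigma> i\<close>, \<open>card_crossing_level\<close> turns these
  positions into those before \<open>\<sigma> i\<close> with value at least
  \<open>\<sigma> i\<close>: the position \<open>i\<close> and those counted by the height.\<close>

lemma card_filled_after:
  assumes "1 \<le> i" "i \<le> n" "i < \<sigma> i"
  shows "(\<Sum>j=1..n. of_bool (\<sigma> i \<le> j \<and> \<sigma> j < \<sigma> i)) = Suc (exc_height \<sigma> (\<sigma> i))"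
proof -
  have "{j \<in> {1..n}. j < \<sigma> i \<and> \<sigma> i \<le> \<sigma> j} = insert i {j. j < \<sigma> i \<and> \<sigma> i < \<sigma> j}"
  proof -
    have "1 \<le> j \<and> j \<le> n" if "j < \<sigma> i" "\<sigma> i < \<sigma> j" for j
      using that perm_outside[OF \<sigma>, of j] by (cases "j = 0 \<or> n < j") auto
    then have "j \<in> {j \<in> {1..n}. j < \<sigma> i \<and> \<sigma> i \<le> \<sigma> j} \<longleftrightarrow>
        j \<in> insert i {j. j < \<sigma> i \<and> \<sigma> i < \<sigma> j}" for j
      using assms perm_eq_iff[OF \<sigma>, of j i] by (cases "j = i") (auto simp: le_less)
    then show ?thesis by (rule set_eqI)
  qed
  then have "card {j \<in> {1..n}. j < \<sigma> i \<and> \<sigma> i \<le> \<sigma> j} = Suc (exc_height \<sigma> (\<sigma> i))"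
    by (simp add: exc_height_def)
  then show ?thesis
    using card_crossing_level[OF \<sigma>, of "\<sigma> i"] by (simp add: Int_def)
qed

text \<open>An inversion \<open>(i, j)\<close> with \<open>\<sigma> i \<le> i\<close> is charged to
  \<open>i\<close> and counted by \<open>nest_pos\<close>. If \<open>i < \<sigma> i \<le> j\<close>,
  it is charged to \<open>i\<close> and counted by \<open>card_filled_after\<close>. If
  \<open>j < \<sigma> i\<close>, it is charged to \<open>j\<close> and counted by the height when
  \<open>\<sigma> j \<le> j\<close>, by \<open>nest_val\<close> otherwise.\<close>

lemma inversions_eq_sum:
  "inversions n \<sigma> = (\<Sum>i=1..n. if i < \<sigma> i
     then Suc (nest_val \<sigma> (\<sigma> i) + exc_height \<sigma> (\<sigma> i)) else exc_height \<sigma> i + nest_pos \<sigma> i)"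
proof -
  have "inversions n \<sigma> = (\<Sum>i=1..n. \<Sum>j=1..n. of_bool (1 \<le> i \<and> i < j \<and> j \<le> n \<and> \<sigma> j < \<sigma> i))"
    unfolding inversions_def by (rule card_pairs) auto
  also have "\<dots> = (\<Sum>i=1..n. \<Sum>j=1..n.
      of_bool (\<sigma> j \<le> j \<and> i < j \<and> j < \<sigma> i) + of_bool (\<sigma> i \<le> i \<and> i < j \<and> \<sigma> j < \<sigma> i)
      + of_bool (j < \<sigma> j \<and> i < j \<and> \<sigma> j < \<sigma> i) + of_bool (i < \<sigma> i \<and> \<sigma> i \<le> j \<and> \<sigma> j < \<sigma> i))"
    by (intro sum.cong refl) (auto simp: of_bool_def)
  also have "\<dots> = (\<Sum>j=1..n. \<Sum>i=1..n. of_bool (\<sigma> j \<le> j \<and> i < j \<and> j < \<sigma> i))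
      + (\<Sum>i=1..n. \<Sum>j=1..n. of_bool (\<sigma> i \<le> i \<and> i < j \<and> \<sigma> j < \<sigma> i))
      + (\<Sum>j=1..n. \<Sum>i=1..n. of_bool (j < \<sigma> j \<and> i < j \<and> \<sigma> j < \<sigma> i))
      + (\<Sum>i=1..n. \<Sum>j=1..n. of_bool (i < \<sigma> i \<and> \<sigma> i \<le> j \<and> \<sigma> j < \<sigma> i))"
    unfolding sum.distrib by (intro arg_cong2[where f = "(+)"] refl sum.swap)
  also have "\<dots> = (\<Sum>i=1..n.
      (if \<sigma> i \<le> i then exc_height \<sigma> i else 0) + (if \<sigma> i \<le> i then nest_pos \<sigma> i else 0)
      + (if i < \<sigma> i then nest_val \<sigma> (\<sigma> i) else 0)
      + (if i < \<sigma> i then Suc (exc_height \<sigma> (\<sigma> i)) else 0))"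
    unfolding sum.distrib sum_of_bool_conj
  proof (intro arg_cong2[where f = "(+)"] sum.cong refl if_cong)
    fix i assume "i \<in> {1..n}"
    then have i: "1 \<le> i" "i \<le> n" by auto
    have pos: "1 \<le> j" if "i \<le> \<sigma> j \<or> \<sigma> i < \<sigma> j" for j
      using that i perm_zero[OF \<sigma>] by (cases "j = 0") auto
    show "(\<Sum>j=1..n. of_bool (j < i \<and> i < \<sigma> j)) = exc_height \<sigma> i"
      unfolding exc_height_def by (rule sum_of_bool_card) (use i pos in auto)
    show "(\<Sum>j=1..n. of_bool (j < i \<and> \<sigma> i < \<sigma> j)) = nest_val \<sigma> (\<sigma> i)"
      unfolding nest_val_def inv_perm[OF \<sigma>] by (rule sum_of_bool_card) (use i pos in auto)
    show "(\<Sum>j=1..n. of_bool (i < j \<and> \<sigma> j < \<sigma> i)) = nest_pos \<sigma> i" if "\<sigma> i \<le> i"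
      unfolding nest_pos_def
    proof (rule sum_of_bool_card)
      show "j \<in> {1..n}" if "i < j \<and> \<sigma> j < \<sigma> i" for j
        using that i \<open>\<sigma> i \<le> i\<close> perm_outside[OF \<sigma>, of j] by (cases "n < j") auto
    qed simp
    show "(\<Sum>j=1..n. of_bool (\<sigma> i \<le> j \<and> \<sigma> j < \<sigma> i)) = Suc (exc_height \<sigma> (\<sigma> i))"
      if "i < \<sigma> i"
      using card_filled_after[OF i that] .
  qed
  also have "\<dots> = (\<Sum>i=1..n. if i < \<sigma> i
     then Suc (nest_val \<sigma> (\<sigma> i) + exc_height \<sigma> (\<sigma> i)) else exc_height \<sigma> i + nest_pos \<sigma> i)"
    by (intro sum.cong refl) auto
  finally show ?thesis .
qed

lemma exc_weight_code:
  "exc_weight (exc_height \<sigma> j) (exc_type \<sigma> j) (exc_label \<sigma> j) =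
    (if j < \<sigma> j then 0 else exc_height \<sigma> j + nest_pos \<sigma> j)
    + (if inv \<sigma> (Suc j) < Suc j then nest_val \<sigma> (Suc j) + exc_height \<sigma> (Suc j) else 0)"
  using exc_height_Suc'[OF \<sigma>, of j] by (auto simp: exc_type_def exc_label_def)

text \<open>The \<open>Suc\<close> in \<open>inversions_eq_sum\<close> occurs once per exceedance
  and cancels \<open>exc\<close>, so the subtraction does not truncate.\<close>

lemma inversions_minus_exc:
  assumes "1 \<le> n"
  shows "inversions n \<sigma> - exc n \<sigma>
    = (\<Sum>j=1..<n. exc_weight (exc_height \<sigma> j) (exc_type \<sigma> j) (exc_label \<sigma> j))"
proof -
  define A where "A i = (if i < \<sigma> i then 0 else exc_height \<sigma> i + nest_pos \<sigma> i)" for i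
  define B where "B v = (if inv \<sigma> v < v then nest_val \<sigma> v + exc_height \<sigma> v else 0)" for v
  have "inversions n \<sigma> = (\<Sum>i=1..n. A i + (B (\<sigma> i) + of_bool (i < \<sigma> i)))"
    unfolding inversions_eq_sum A_def B_def
    by (intro sum.cong refl) (auto simp: inv_perm[OF \<sigma>])
  moreover have "exc n \<sigma> = (\<Sum>i=1..n. of_bool (i < \<sigma> i))"
    by (simp add: exc_def Int_def)
  ultimately have "inversions n \<sigma> - exc n \<sigma> = (\<Sum>i=1..n. A i) + (\<Sum>i=1..n. B (\<sigma> i))"
    by (simp add: sum.distrib)
  \<comment> \<open>The exceedance terms depend on the value alone. Value \<open>v\<close> is
    treated at step \<open>v - 1\<close>, and value 1 contributes nothing.\<close>
  also have "(\<Sum>i=1..n. B (\<sigma> i)) = (\<Sum>v=1..n. B v)"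
    using sum.permute[OF perms_permutes[OF \<sigma>], of B] by (simp add: comp_def)
  also have "(\<Sum>v=1..n. B v) = (\<Sum>j=1..<n. B (Suc j))"
  proof -
    have "inv \<sigma> 1 \<noteq> 0" using perm_inv[OF \<sigma>, of 1] perm_zero[OF \<sigma>] by (metis zero_neq_one)
    then have "B 1 = 0" by (simp add: B_def)
    moreover obtain m where n: "n = Suc m" using assms by (cases n) auto
    ultimately show ?thesis
      unfolding n by (simp add: sum.atLeast_Suc_atMost sum.shift_bounds_cl_Suc_ivl atLeastLessThanSuc_atLeastAtMost
          del: sum.cl_ivl_Suc)
  qed
  also have "(\<Sum>i=1..n. A i) = (\<Sum>i=1..<n. A i)"
  proof -
    have "\<not> \<sigma> j < \<sigma> n" if "n < j" for j
      using that perm_outside[OF \<sigma>, of j] perm_range[OF \<sigma>, of n] assms by simp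
    then have "A n = 0" by (simp add: A_def exc_height_n[OF \<sigma>] nest_pos_def card_eq_0_iff)
    moreover have "{1..n} = insert n {1..<n}" using assms by auto
    ultimately show ?thesis by simp
  qed
  finally show ?thesis
    unfolding exc_weight_code sum.distrib A_def B_def .
qed

lemma exc_eq_sum:
  assumes "1 \<le> n"
  shows "exc n \<sigma> = (\<Sum>j=1..<n. of_bool (fst (exc_type \<sigma> j)))"
proof -
  have "\<not> n < \<sigma> n" using perm_range[OF \<sigma>, of n] assms by auto
  then have "{i \<in> {1..n}. i < \<sigma> i} = {i \<in> {1..<n}. i < \<sigma> i}"
    by (auto simp: order_le_less)
  then show ?thesis by (simp add: exc_def exc_type_def Int_def)
qed

lemma scda_eq_0_iff: "scda n \<sigma> = 0 \<longleftrightarrow> (\<forall>j\<in>{1..<n}. exc_type \<sigma> j \<noteq> (True, True))"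
proof -
  have "inv_into {1..n} \<sigma> (Suc j) = inv \<sigma> (Suc j)" if "j \<in> {1..n - 1}" for j
    using that by (intro inv_into_eq_inv[OF \<sigma>]) auto
  then have "{i \<in> {1..n-1}. i < \<sigma> i \<and> inv_into {1..n} \<sigma> (Suc i) < Suc i}
    = {i \<in> {1..<n}. exc_type \<sigma> i = (True, True)}"
    by (auto simp: exc_type_def)
  then show ?thesis by (auto simp: scda_def)
qed

text \<open>An index counted by scda with \<open>\<sigma> i = i + 1\<close> is a fixed point of the star companion,
  any other one is a double ascent of it.\<close>

lemma cda_star_fix_star_eq_0_iff: "cda_star n \<sigma> + fix_star n \<sigma> = 0 \<longleftrightarrow> scda n \<sigma> = 0"
proof -
  \<comment> \<open>The shift by one makes the preimage of \<open>i\<close> the position of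
    \<open>i + 1\<close>; the value \<open>n\<close> at 0 is taken nowhere else, as the other values
    are at most \<open>n - 1\<close>.\<close>
  have inv_star: "inv_into {0..n} (star n \<sigma>) i = inv \<sigma> (Suc i)" if i: "1 \<le> i" "i < n" for i
  proof (rule inv_into_f_eq)
    have pos: "1 \<le> \<sigma> j \<and> \<sigma> j \<le> n" if "j \<noteq> 0" "j \<le> n" for j using perm_range[OF \<sigma>, of j] that by auto
    show "inj_on (star n \<sigma>) {0..n}"
    proof (rule inj_onI)
      fix x y assume "x \<in> {0..n}" "y \<in> {0..n}" "star n \<sigma> x = star n \<sigma> y"
      then show "x = y"
        using pos[of x] pos[of y] perm_eq_iff[OF \<sigma>, of x y]
        by (cases "x = 0"; cases "y = 0") (simp add: star_def; linarith)+
    qed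
    have "1 \<le> inv \<sigma> (Suc i)" "inv \<sigma> (Suc i) \<le> n" using inv_range[OF \<sigma>, of "Suc i"] i by auto
    then show "inv \<sigma> (Suc i) \<in> {0..n}" "star n \<sigma> (inv \<sigma> (Suc i)) = i"
      by (auto simp: star_def perm_inv[OF \<sigma>])
  qed
  have "(inv_into {0..n} (star n \<sigma>) i < i \<and> i < star n \<sigma> i) \<or> star n \<sigma> i = i
      \<longleftrightarrow> i < \<sigma> i \<and> inv_into {1..n} \<sigma> (Suc i) < Suc i" if "i \<in> {1..n - 1}" for i
  proof -
    have i: "1 \<le> i" "i < n" using that by auto
    have "inv_into {1..n} \<sigma> (Suc i) = inv \<sigma> (Suc i)"
      using i by (intro inv_into_eq_inv[OF \<sigma>]) auto
    moreover have "inv \<sigma> (Suc i) = i \<longleftrightarrow> \<sigma> i = Suc i" by (rule inv_eq_iff[OF \<sigma>])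
    moreover have "1 \<le> \<sigma> i" using perm_range[OF \<sigma>, of i] i by simp
    ultimately show ?thesis using inv_star[OF i] i by (auto simp: star_def)
  qed
  then have "(\<forall>i\<in>{1..n-1}. \<not> (inv_into {0..n} (star n \<sigma>) i < i \<and> i < star n \<sigma> i) \<and> star n \<sigma> i \<noteq> i)
      \<longleftrightarrow> (\<forall>i\<in>{1..n-1}. \<not> (i < \<sigma> i \<and> inv_into {1..n} \<sigma> (Suc i) < Suc i))"
    by blast
  then show ?thesis
    unfolding cda_star_def fix_star_def scda_def add_is_0 card_filter_eq_0_iff[OF finite_atLeastAtMost]
    by blast
qed

end

lemma DE_star_eq_SDE: "DE_star n k = SDE n k"
  unfolding DE_star_def SDE_def by (intro Collect_cong conj_cong refl cda_star_fix_star_eq_0_iff)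

section \<open>Coding by the letters of the word\<close>

text \<open>Letters \<open>\<ge> c\<close> form maximal runs in the word; each run is entered by one upcrossing of level
  \<open>c\<close>, and the height at \<open>c\<close> is the number of runs minus one.\<close>

definition upcross :: "nat \<Rightarrow> (nat \<Rightarrow> nat) \<Rightarrow> nat \<Rightarrow> nat \<Rightarrow> nat" where
  "upcross n \<sigma> c m = card {i. i < m \<and> ext0 n \<sigma> i < c \<and> c \<le> ext0 n \<sigma> (Suc i)}"

definition downcross :: "nat \<Rightarrow> (nat \<Rightarrow> nat) \<Rightarrow> nat \<Rightarrow> nat \<Rightarrow> nat" where
  "downcross n \<sigma> c m = card {i. i < m \<and> c \<le> ext0 n \<sigma> i \<and> ext0 n \<sigma> (Suc i) < c}"

definition word_height :: "nat \<Rightarrow> (nat \<Rightarrow> nat) \<Rightarrow> nat \<Rightarrow> nat" where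
  "word_height n \<sigma> c = upcross n \<sigma> c (Suc n) - 1"

text \<open>With 0 at both ends of the word, \<open>(True, False)\<close> is a valley, which splits
  a run when the level rises past \<open>c\<close>; \<open>(False, True)\<close> is a peak, whose
  run disappears; \<open>(True, True)\<close> is a double descent.\<close>

definition word_type :: "nat \<Rightarrow> (nat \<Rightarrow> nat) \<Rightarrow> nat \<Rightarrow> bool \<times> bool" where
  "word_type n \<sigma> c = (c < ext0 n \<sigma> (inv \<sigma> c - 1), ext0 n \<sigma> (Suc (inv \<sigma> c)) < c)"

definition left_31 :: "(nat \<Rightarrow> nat) \<Rightarrow> nat \<Rightarrow> nat" where
  "left_31 \<sigma> c = card {i. 1 \<le> i \<and> Suc i < inv \<sigma> c \<and> \<sigma> (Suc i) < c \<and> c < \<sigma> i}"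

definition right_13 :: "nat \<Rightarrow> (nat \<Rightarrow> nat) \<Rightarrow> nat \<Rightarrow> nat" where
  "right_13 n \<sigma> c = card {i. inv \<sigma> c < i \<and> i < n \<and> \<sigma> i < c \<and> c < \<sigma> (Suc i)}"

text \<open>The label tells which of the \<open>h + 1\<close> runs contains the letter. A peak at
  height 0 would delete the only run, which is impossible while larger letters remain.\<close>

fun word_choices :: "nat \<Rightarrow> bool \<times> bool \<Rightarrow> nat set" where
  "word_choices h (u, d) = (if \<not> u \<and> d \<and> h = 0 then {} else {..h})"

lemma finite_word_choices: "finite (word_choices h t)"
  by (cases t) auto

lemma upcross_mono: "m \<le> m' \<Longrightarrow> upcross n \<sigma> c m \<le> upcross n \<sigma> c m'"
  unfolding upcross_def by (rule card_mono) auto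

lemma downcross_mono: "m \<le> m' \<Longrightarrow> downcross n \<sigma> c m \<le> downcross n \<sigma> c m'"
  unfolding downcross_def by (rule card_mono) auto

text \<open>Crossings alternate, and the word starts below the level because \<open>ext0\<close> is
  0 at position 0.\<close>

lemma upcross_eq_downcross:
  assumes "1 \<le> c"
  shows "upcross n \<sigma> c m = downcross n \<sigma> c m + of_bool (c \<le> ext0 n \<sigma> m)"
proof (induction m)
  case 0
  then show ?case using assms by (simp add: upcross_def downcross_def ext0_def)
next
  case (Suc m)
  then show ?case
    unfolding upcross_def downcross_def card_less_Suc by auto
qed

context
  fixes n :: nat and \<sigma> :: "nat \<Rightarrow> nat"
  assumes \<sigma>: "\<sigma> \<in> perms n"
begin

lemma ext0_le: "i \<le> Suc n \<Longrightarrow> ext0 n \<sigma> i \<le> n"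
  using perm_range[OF \<sigma>, of i] by (auto simp: ext0_def)

lemma inv_bounds:
  assumes "1 \<le> c" "c \<le> n"
  shows "1 \<le> inv \<sigma> c" "inv \<sigma> c \<le> n"
  using inv_range[OF \<sigma>, of c] assms by auto

lemma ext0_eq_iff:
  assumes "1 \<le> c" "c \<le> n"
  shows "ext0 n \<sigma> i = c \<longleftrightarrow> i = inv \<sigma> c"
  using inv_bounds[OF assms] assms inv_eq_iff[OF \<sigma>, of c i] by (auto simp: ext0_def)

text \<open>Raising the level past \<open>c\<close> changes only the two gaps next to the letter
  \<open>c\<close>: an upcrossing into \<open>c\<close> is lost, and one from \<open>c\<close> to a
  larger right neighbour is gained.\<close>

lemma upcross_step:
  assumes c: "1 \<le> c" "c \<le> n"
  shows "upcross n \<sigma> (Suc c) m + of_bool (ext0 n \<sigma> (inv \<sigma> c - 1) < c \<and> inv \<sigma> c \<le> m)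
    = upcross n \<sigma> c m + of_bool (c < ext0 n \<sigma> (Suc (inv \<sigma> c)) \<and> inv \<sigma> c < m)"
proof (induction m)
  case 0
  then show ?case using inv_bounds[OF c] by (simp add: upcross_def)
next
  case (Suc m)
  define p where "p = inv \<sigma> c"
  define s where "s = ext0 n \<sigma>"
  have eq: "s i = c \<longleftrightarrow> i = p" for i unfolding s_def p_def by (rule ext0_eq_iff[OF c])
  have up: "upcross n \<sigma> c' (Suc m) = upcross n \<sigma> c' m + of_bool (s m < c' \<and> c' \<le> s (Suc m))" for c'
    unfolding upcross_def card_less_Suc s_def by simp
  note IH = Suc.IH[folded p_def s_def]
  consider "m = p" | "Suc m = p" | "m \<noteq> p" "Suc m \<noteq> p" by blast
  then show ?case
    unfolding up p_def[symmetric] s_def[symmetric]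
  proof cases
    case 1
    then have "s m = c" using eq by simp
    then show "upcross n \<sigma> (Suc c) m + of_bool (s m < Suc c \<and> Suc c \<le> s (Suc m))
        + of_bool (s (p - 1) < c \<and> p \<le> Suc m) =
      upcross n \<sigma> c m + of_bool (s m < c \<and> c \<le> s (Suc m)) + of_bool (c < s (Suc p) \<and> p < Suc m)"
      using IH 1 by (auto simp: Suc_le_eq)
  next
    case 2
    then have "s (Suc m) = c" using eq by simp
    then show "upcross n \<sigma> (Suc c) m + of_bool (s m < Suc c \<and> Suc c \<le> s (Suc m))
        + of_bool (s (p - 1) < c \<and> p \<le> Suc m) =
      upcross n \<sigma> c m + of_bool (s m < c \<and> c \<le> s (Suc m)) + of_bool (c < s (Suc p) \<and> p < Suc m)"
      using IH 2[symmetric] by auto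
  next
    case 3
    then have "s m \<noteq> c" "s (Suc m) \<noteq> c" using eq by auto
    then have "s m < Suc c \<and> Suc c \<le> s (Suc m) \<longleftrightarrow> s m < c \<and> c \<le> s (Suc m)" by auto
    moreover have "p \<le> Suc m \<longleftrightarrow> p \<le> m" "p < Suc m \<longleftrightarrow> p < m" using 3 by auto
    ultimately show "upcross n \<sigma> (Suc c) m + of_bool (s m < Suc c \<and> Suc c \<le> s (Suc m))
        + of_bool (s (p - 1) < c \<and> p \<le> Suc m) =
      upcross n \<sigma> c m + of_bool (s m < c \<and> c \<le> s (Suc m)) + of_bool (c < s (Suc p) \<and> p < Suc m)"
      using IH by simp
  qed
qed

lemma word_type_alt:
  assumes c: "1 \<le> c" "c \<le> n"
  shows "ext0 n \<sigma> (inv \<sigma> c - 1) < c \<longleftrightarrow> \<not> fst (word_type n \<sigma> c)"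
    "c < ext0 n \<sigma> (Suc (inv \<sigma> c)) \<longleftrightarrow> \<not> snd (word_type n \<sigma> c)"
  using inv_bounds[OF c] ext0_eq_iff[OF c, of "inv \<sigma> c - 1"] ext0_eq_iff[OF c, of "Suc (inv \<sigma> c)"]
  by (auto simp: word_type_def)

text \<open>A downcrossing left of \<open>c\<close> is the \<open>31\<close> of a
  \<open>31-2\<close>. The ends cause no exception: position 0 lies below the level, and the gap
  just before \<open>c\<close> ends at the level.\<close>

lemma downcross_at:
  assumes c: "1 \<le> c" "c \<le> n"
  shows "downcross n \<sigma> c (inv \<sigma> c) = left_31 \<sigma> c"
proof -
  have "i < inv \<sigma> c \<and> c \<le> ext0 n \<sigma> i \<and> ext0 n \<sigma> (Suc i) < c \<longleftrightarrow>
      1 \<le> i \<and> Suc i < inv \<sigma> c \<and> \<sigma> (Suc i) < c \<and> c < \<sigma> i" for i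
  proof (cases "1 \<le> i \<and> Suc i < inv \<sigma> c")
    case True
    then have "ext0 n \<sigma> i = \<sigma> i" "ext0 n \<sigma> (Suc i) = \<sigma> (Suc i)" "\<sigma> i \<noteq> c"
      using inv_bounds[OF c] inv_perm[OF \<sigma>, of i] by (auto simp: ext0_def)
    then show ?thesis using True by auto
  next
    case False
    then have "i = 0 \<or> inv \<sigma> c \<le> i \<or> ext0 n \<sigma> (Suc i) = c"
      using ext0_eq_iff[OF c, of "Suc i"] by linarith
    then show ?thesis using False c by (auto simp: ext0_def)
  qed
  then show ?thesis unfolding downcross_def left_31_def by simp
qed

lemma upcross_at:
  assumes c: "1 \<le> c" "c \<le> n"
  shows "upcross n \<sigma> c (inv \<sigma> c) = Suc (left_31 \<sigma> c)"
  using upcross_eq_downcross[OF c(1), of n \<sigma> "inv \<sigma> c"] downcross_at[OF c]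
    ext0_eq_iff[OF c, of "inv \<sigma> c"] by simp

lemma upcross_total:
  assumes c: "1 \<le> c" "c \<le> n"
  shows "upcross n \<sigma> c (Suc n) = Suc (word_height n \<sigma> c)"
  using upcross_mono[of "inv \<sigma> c" "Suc n" n \<sigma> c] upcross_at[OF c] inv_bounds[OF c]
  by (simp add: word_height_def)

text \<open>Upcrossings after \<open>c\<close> are the \<open>13\<close> of a \<open>2-13\<close>.
  Those before it exceed the number of \<open>31\<close> by one, for the run of \<open>c\<close>,
  which the height leaves out.\<close>

lemma word_height_split:
  assumes c: "1 \<le> c" "c \<le> n"
  shows "word_height n \<sigma> c = left_31 \<sigma> c + right_13 n \<sigma> c"
proof -
  have "{i. i < Suc n \<and> ext0 n \<sigma> i < c \<and> c \<le> ext0 n \<sigma> (Suc i)} =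
      {i. i < inv \<sigma> c \<and> ext0 n \<sigma> i < c \<and> c \<le> ext0 n \<sigma> (Suc i)} \<union>
      {i. inv \<sigma> c < i \<and> i < n \<and> \<sigma> i < c \<and> c < \<sigma> (Suc i)}" (is "?L = ?A \<union> ?B")
  proof (rule set_eqI)
    fix i
    note b = inv_bounds[OF c]
    have "i \<in> ?L \<longleftrightarrow> i \<in> ?B" if "inv \<sigma> c < i"
    proof (cases "i < n")
      case True
      then have "ext0 n \<sigma> i = \<sigma> i" "ext0 n \<sigma> (Suc i) = \<sigma> (Suc i)" "\<sigma> (Suc i) \<noteq> c"
        using that inv_perm[OF \<sigma>, of "Suc i"] by (auto simp: ext0_def)
      then show ?thesis using True that by auto
    next
      case False
      then show ?thesis using c by (cases "i = n") (auto simp: ext0_def)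
    qed
    moreover have "ext0 n \<sigma> i = c" if "i = inv \<sigma> c" using that ext0_eq_iff[OF c] by simp
    ultimately show "i \<in> ?L \<longleftrightarrow> i \<in> ?A \<union> ?B"
      using b by (cases i "inv \<sigma> c" rule: linorder_cases) auto
  qed
  then have "upcross n \<sigma> c (Suc n) = upcross n \<sigma> c (inv \<sigma> c) + right_13 n \<sigma> c"
    unfolding upcross_def right_13_def by (simp add: card_Un_disjoint disjoint_iff)
  then show ?thesis using upcross_at[OF c] upcross_total[OF c] by simp
qed

lemma word_height_Suc':
  assumes c: "1 \<le> c" "c < n"
  shows "word_height n \<sigma> (Suc c) + of_bool (snd (word_type n \<sigma> c))
    = word_height n \<sigma> c + of_bool (fst (word_type n \<sigma> c))"
proof -
  have c': "1 \<le> c" "c \<le> n" using c by auto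
  show ?thesis
    using upcross_step[OF c', of "Suc n"] upcross_total[OF c'] upcross_total[of "Suc c"] c inv_bounds[OF c']
    unfolding word_type_alt[OF c'] by (auto split: if_splits)
qed

lemma word_height_Suc:
  assumes c: "1 \<le> c" "c < n"
  shows "word_height n \<sigma> (Suc c) = next_height (word_height n \<sigma> c) (word_type n \<sigma> c)"
  using word_height_Suc'[OF c] by (cases "word_type n \<sigma> c") auto

lemma word_height_1:
  assumes "1 \<le> n"
  shows "word_height n \<sigma> 1 = 0"
proof -
  have "i = 0" if "i < Suc n" "ext0 n \<sigma> i < 1" for i
    using that perm_range[OF \<sigma>, of i] by (cases "i = 0") (auto simp: ext0_def)
  then have "{i. i < Suc n \<and> ext0 n \<sigma> i < 1 \<and> 1 \<le> ext0 n \<sigma> (Suc i)} \<subseteq> {0}"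
    by blast
  then have "upcross n \<sigma> 1 (Suc n) \<le> card {0::nat}"
    unfolding upcross_def by (intro card_mono) auto
  then show ?thesis using upcross_total[of 1] assms by simp
qed

lemma left_31_n: "left_31 \<sigma> n = 0" and right_13_n: "right_13 n \<sigma> n = 0"
proof -
  have "\<not> n < \<sigma> i" if "i \<le> n" for i
    using perm_range[OF \<sigma>, of i] perm_zero[OF \<sigma>] that by (cases "i = 0") auto
  moreover from this[of 0] have "inv \<sigma> n \<le> n"
    using inv_range[OF \<sigma>, of n] inv_eq_iff[OF \<sigma>, of 0 0] perm_zero[OF \<sigma>] by (cases "n = 0") auto
  ultimately have "{i. 1 \<le> i \<and> Suc i < inv \<sigma> n \<and> \<sigma> (Suc i) < n \<and> n < \<sigma> i} = {}"
    "{i. inv \<sigma> n < i \<and> i < n \<and> \<sigma> i < n \<and> n < \<sigma> (Suc i)} = {}"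
    by auto
  then show "left_31 \<sigma> n = 0" "right_13 n \<sigma> n = 0"
    unfolding left_31_def right_13_def by (simp_all only: card.empty)
qed

lemma word_height_n:
  assumes "1 \<le> n"
  shows "word_height n \<sigma> n = 0"
  using word_height_split[OF assms] by (simp add: left_31_n right_13_n)

lemma left_31_mem:
  assumes c: "1 \<le> c" "c < n"
  shows "left_31 \<sigma> c \<in> word_choices (word_height n \<sigma> c) (word_type n \<sigma> c)"
  using word_height_split[of c] word_height_Suc'[OF c] c by (cases "word_type n \<sigma> c") auto

text \<open>The letter \<open>x\<close> lies below level \<open>c\<close>, so its up- and
  downcrossings to the left are equally many, whereas \<open>c\<close> has \<open>left_31\<close>
  downcrossings and one more upcrossing. Monotonicity of the counts then decides the order.\<close>

lemma before_iff:
  assumes x: "1 \<le> x" "x < c" "c \<le> n"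
  shows "inv \<sigma> x < inv \<sigma> c \<longleftrightarrow> upcross n \<sigma> c (inv \<sigma> x) \<le> left_31 \<sigma> c"
proof
  assume "inv \<sigma> x < inv \<sigma> c"
  then have "downcross n \<sigma> c (inv \<sigma> x) \<le> left_31 \<sigma> c"
    using downcross_mono[of "inv \<sigma> x" "inv \<sigma> c" n \<sigma> c] downcross_at[of c] x by simp
  moreover have "ext0 n \<sigma> (inv \<sigma> x) = x" using ext0_eq_iff[of x] x by simp
  ultimately show "upcross n \<sigma> c (inv \<sigma> x) \<le> left_31 \<sigma> c"
    using upcross_eq_downcross[of c n \<sigma> "inv \<sigma> x"] x by simp
next
  assume "upcross n \<sigma> c (inv \<sigma> x) \<le> left_31 \<sigma> c"
  then have "\<not> upcross n \<sigma> c (inv \<sigma> c) \<le> upcross n \<sigma> c (inv \<sigma> x)"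
    using upcross_at[of c] x by simp
  then show "inv \<sigma> x < inv \<sigma> c" using upcross_mono[of "inv \<sigma> c" "inv \<sigma> x" n \<sigma> c] by linarith
qed

text \<open>Positions are ranks, so the pairwise order of the letters determines the word.\<close>

lemma inv_eq_rank:
  assumes "1 \<le> x" "x \<le> n"
  shows "inv \<sigma> x = card {y \<in> {1..n}. inv \<sigma> y \<le> inv \<sigma> x}"
proof -
  have "1 \<le> \<sigma> i \<and> \<sigma> i \<le> n" if "1 \<le> i" "i \<le> inv \<sigma> x" for i
    using perm_range[OF \<sigma>, of i] inv_bounds(2)[OF assms] that by simp
  then have "bij_betw (inv \<sigma>) {y \<in> {1..n}. inv \<sigma> y \<le> inv \<sigma> x} {1..inv \<sigma> x}"
    using inv_bounds(1)
    by (intro bij_betwI[where g = \<sigma>]) (auto simp: perm_inv[OF \<sigma>] inv_perm[OF \<sigma>])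
  then show ?thesis using bij_betw_same_card by fastforce
qed

end

text \<open>By induction on \<open>c\<close>, the code determines between which runs of letters \<open>\<ge> c\<close> each smaller letter
  lies, and hence on which side of \<open>c\<close>.\<close>

lemma word_code_inj:
  assumes \<sigma>: "\<sigma> \<in> perms n" and \<tau>: "\<tau> \<in> perms n"
    and code: "\<And>c. 1 \<le> c \<Longrightarrow> c < n \<Longrightarrow> word_type n \<sigma> c = word_type n \<tau> c \<and> left_31 \<sigma> c = left_31 \<tau> c"
  shows "\<sigma> = \<tau>"
proof -
  have left: "left_31 \<sigma> c = left_31 \<tau> c" if "1 \<le> c" "c \<le> n" for c
    using code[of c] that left_31_n[OF \<sigma>] left_31_n[OF \<tau>] by (cases "c = n") auto
  have gaps: "\<forall>x. 1 \<le> x \<and> x < c \<longrightarrow> upcross n \<sigma> c (inv \<sigma> x) = upcross n \<tau> c (inv \<tau> x)"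
    if "1 \<le> c" "c \<le> n" for c
    using that
  proof (induction c rule: nat_induct_at_least)
    case (Suc c)
    then have c: "1 \<le> c" "c \<le> n" "c < n" by auto
    note step = upcross_step[OF \<sigma> c(1,2)] upcross_step[OF \<tau> c(1,2)]
    note type = word_type_alt[OF \<sigma> c(1,2)] word_type_alt[OF \<tau> c(1,2)] code[OF c(1,3)]
    show ?case
    proof (intro allI impI)
      fix x assume x: "1 \<le> x \<and> x < Suc c"
      show "upcross n \<sigma> (Suc c) (inv \<sigma> x) = upcross n \<tau> (Suc c) (inv \<tau> x)"
      proof (cases "x = c")
        case True
        then show ?thesis
          using step[of "inv \<sigma> c"] step(2)[of "inv \<tau> c"] type upcross_at[OF \<sigma> c(1,2)]
            upcross_at[OF \<tau> c(1,2)] left[OF c(1,2)] by simp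
      next
        case False
        then have x': "1 \<le> x" "x < c" using x by auto
        have eq: "upcross n \<sigma> c (inv \<sigma> x) = upcross n \<tau> c (inv \<tau> x)"
          using Suc.IH c x' by simp
        \<comment> \<open>The gap of \<open>x\<close> and the label of \<open>c\<close> decide the
          side of \<open>c\<close> on which \<open>x\<close> lies, and this fixes both indicator
          terms of \<open>upcross_step\<close>.\<close>
        then have "inv \<sigma> x < inv \<sigma> c \<longleftrightarrow> inv \<tau> x < inv \<tau> c"
          unfolding before_iff[OF \<sigma> x' c(2)] before_iff[OF \<tau> x' c(2)] left[OF c(1,2)] by simp
        moreover have "inv \<sigma> x \<noteq> inv \<sigma> c" "inv \<tau> x \<noteq> inv \<tau> c"
          using x' perm_inv[OF \<sigma>] perm_inv[OF \<tau>] by (metis less_irrefl)+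
        ultimately have "inv \<sigma> c \<le> inv \<sigma> x \<longleftrightarrow> inv \<tau> c \<le> inv \<tau> x"
          "inv \<sigma> c < inv \<sigma> x \<longleftrightarrow> inv \<tau> c < inv \<tau> x" by linarith+
        then show ?thesis
          using step(1)[of "inv \<sigma> x"] step(2)[of "inv \<tau> x"] type eq by simp
      qed
    qed
  qed simp
  have lt: "inv \<sigma> x < inv \<sigma> c \<longleftrightarrow> inv \<tau> x < inv \<tau> c" if "1 \<le> x" "x < c" "c \<le> n" for x c
    unfolding before_iff[OF \<sigma> that] before_iff[OF \<tau> that] using gaps[of c] left[of c] that by simp
  have le: "inv \<sigma> y \<le> inv \<sigma> x \<longleftrightarrow> inv \<tau> y \<le> inv \<tau> x" if "1 \<le> x" "x \<le> n" "1 \<le> y" "y \<le> n" for x y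
    using lt[of x y] lt[of y x] that inv_eq_iff[OF \<sigma>, of x "inv \<sigma> y"] inv_eq_iff[OF \<tau>, of x "inv \<tau> y"]
      perm_inv[OF \<sigma>, of y] perm_inv[OF \<tau>, of y]
    by (cases x y rule: linorder_cases) (simp_all, linarith+)
  have inv_eq: "inv \<sigma> x = inv \<tau> x" if x: "1 \<le> x" "x \<le> n" for x
  proof -
    have "{y \<in> {1..n}. inv \<sigma> y \<le> inv \<sigma> x} = {y \<in> {1..n}. inv \<tau> y \<le> inv \<tau> x}"
      using le[OF x] by auto
    then show ?thesis
      using inv_eq_rank[OF \<sigma> x] inv_eq_rank[OF \<tau> x] by (simp only:)
  qed
  show ?thesis
  proof (rule perms_eqI[OF \<sigma> \<tau>])
    fix i assume "1 \<le> i" "i \<le> n"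
    then have "inv \<tau> (\<sigma> i) = i"
      using inv_eq[of "\<sigma> i"] perm_range[OF \<sigma>, of i] inv_perm[OF \<sigma>] by simp
    then show "\<sigma> i = \<tau> i" using inv_eq_iff[OF \<tau>, of "\<sigma> i" i] by simp
  qed
qed

section \<open>Statistics of the word as sums over letters\<close>

context
  fixes n :: nat and \<sigma> :: "nat \<Rightarrow> nat"
  assumes \<sigma>: "\<sigma> \<in> perms n"
begin

lemma sum_over_letters: "(\<Sum>c=1..n. F (inv \<sigma> c)) = (\<Sum>j=1..n. F j)"
  using sum.permute[OF permutes_inv[OF perms_permutes[OF \<sigma>]], of F] by (simp add: comp_def)

lemma pat31_2_eq_sum: "pat31_2 n \<sigma> = (\<Sum>c=1..n. left_31 \<sigma> c)"
proof -
  have "pat31_2 n \<sigma> = (\<Sum>i=1..n. \<Sum>j=1..n. of_bool (1 \<le> i \<and> i + 1 < j \<and> j \<le> n \<and>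
      \<sigma> (Suc i) < \<sigma> j \<and> \<sigma> j < \<sigma> i))"
    unfolding pat31_2_def by (rule card_pairs) auto
  also have "\<dots> = (\<Sum>j=1..n. \<Sum>i=1..n. of_bool (1 \<le> i \<and> i + 1 < j \<and> j \<le> n \<and>
      \<sigma> (Suc i) < \<sigma> j \<and> \<sigma> j < \<sigma> i))"
    by (rule sum.swap)
  also have "\<dots> = (\<Sum>j=1..n. left_31 \<sigma> (\<sigma> j))"
  proof (rule sum.cong[OF refl])
    fix j assume j: "j \<in> {1..n}"
    have "(\<Sum>i=1..n. of_bool (1 \<le> i \<and> i + 1 < j \<and> j \<le> n \<and> \<sigma> (Suc i) < \<sigma> j \<and> \<sigma> j < \<sigma> i))
      = card {i. 1 \<le> i \<and> i + 1 < j \<and> j \<le> n \<and> \<sigma> (Suc i) < \<sigma> j \<and> \<sigma> j < \<sigma> i}"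
      by (rule sum_of_bool_card) auto
    then show "(\<Sum>i=1..n. of_bool (1 \<le> i \<and> i + 1 < j \<and> j \<le> n \<and> \<sigma> (Suc i) < \<sigma> j \<and> \<sigma> j < \<sigma> i))
      = left_31 \<sigma> (\<sigma> j)"
      using j by (simp add: left_31_def inv_perm[OF \<sigma>])
  qed
  also have "\<dots> = (\<Sum>c=1..n. left_31 \<sigma> (\<sigma> (inv \<sigma> c)))"
    by (rule sum_over_letters[symmetric])
  finally show ?thesis by (simp only: perm_inv[OF \<sigma>])
qed

lemma pat2_13_eq_sum: "pat2_13 n \<sigma> = (\<Sum>c=1..n. right_13 n \<sigma> c)"
proof -
  have "pat2_13 n \<sigma> = (\<Sum>i=1..n. \<Sum>j=1..n. of_bool (1 \<le> j \<and> j < i \<and> i < n \<and>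
      \<sigma> i < \<sigma> j \<and> \<sigma> j < \<sigma> (Suc i)))"
    unfolding pat2_13_def by (rule card_pairs) auto
  also have "\<dots> = (\<Sum>j=1..n. \<Sum>i=1..n. of_bool (1 \<le> j \<and> j < i \<and> i < n \<and>
      \<sigma> i < \<sigma> j \<and> \<sigma> j < \<sigma> (Suc i)))"
    by (rule sum.swap)
  also have "\<dots> = (\<Sum>j=1..n. right_13 n \<sigma> (\<sigma> j))"
  proof (rule sum.cong[OF refl])
    fix j assume j: "j \<in> {1..n}"
    have "(\<Sum>i=1..n. of_bool (1 \<le> j \<and> j < i \<and> i < n \<and> \<sigma> i < \<sigma> j \<and> \<sigma> j < \<sigma> (Suc i)))
      = card {i. 1 \<le> j \<and> j < i \<and> i < n \<and> \<sigma> i < \<sigma> j \<and> \<sigma> j < \<sigma> (Suc i)}"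
      by (rule sum_of_bool_card) auto
    then show "(\<Sum>i=1..n. of_bool (1 \<le> j \<and> j < i \<and> i < n \<and> \<sigma> i < \<sigma> j \<and> \<sigma> j < \<sigma> (Suc i)))
      = right_13 n \<sigma> (\<sigma> j)"
      using j by (simp add: right_13_def inv_perm[OF \<sigma>])
  qed
  also have "\<dots> = (\<Sum>c=1..n. right_13 n \<sigma> (\<sigma> (inv \<sigma> c)))"
    by (rule sum_over_letters[symmetric])
  finally show ?thesis by (simp only: perm_inv[OF \<sigma>])
qed

text \<open>One of the two copies of \<open>left_31\<close> joins \<open>right_13\<close> to form
  the height; the letter \<open>n\<close> contributes 0.\<close>

lemma patterns_eq_sum:
  assumes "1 \<le> n"
  shows "2 * pat31_2 n \<sigma> + pat2_13 n \<sigma> = (\<Sum>c=1..<n. word_height n \<sigma> c + left_31 \<sigma> c)"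
proof -
  have "2 * pat31_2 n \<sigma> + pat2_13 n \<sigma> = (\<Sum>c=1..n. word_height n \<sigma> c + left_31 \<sigma> c)"
    unfolding pat31_2_eq_sum pat2_13_eq_sum sum_distrib_left sum.distrib[symmetric]
    by (intro sum.cong refl) (simp add: word_height_split[OF \<sigma>])
  moreover have "{1..n} = insert n {1..<n}" using assms by auto
  ultimately show ?thesis
    using word_height_n[OF \<sigma> assms] left_31_n[OF \<sigma>] by simp
qed

text \<open>Each descent is marked by its lower letter, which is below \<open>n\<close>.\<close>

lemma des_eq_sum: "des n \<sigma> = (\<Sum>c=1..<n. of_bool (fst (word_type n \<sigma> c)))"
proof -
  have "bij_betw (\<lambda>i. \<sigma> (Suc i)) {i \<in> {1..n-1}. \<sigma> (Suc i) < \<sigma> i} {c \<in> {1..<n}. fst (word_type n \<sigma> c)}"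
  proof (rule bij_betwI[where g = "\<lambda>c. inv \<sigma> c - 1"])
    show "(\<lambda>i. \<sigma> (Suc i)) \<in> {i \<in> {1..n-1}. \<sigma> (Suc i) < \<sigma> i} \<rightarrow> {c \<in> {1..<n}. fst (word_type n \<sigma> c)}"
    proof
      fix i assume "i \<in> {i \<in> {1..n-1}. \<sigma> (Suc i) < \<sigma> i}"
      then have i: "1 \<le> i" "i < n" "\<sigma> (Suc i) < \<sigma> i" by auto
      then have "1 \<le> \<sigma> (Suc i)" "\<sigma> i \<le> n"
        using perm_range[OF \<sigma>, of i] perm_range[OF \<sigma>, of "Suc i"] by auto
      then show "\<sigma> (Suc i) \<in> {c \<in> {1..<n}. fst (word_type n \<sigma> c)}"
        using i by (auto simp: word_type_def inv_perm[OF \<sigma>] ext0_def)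
    qed
    show "(\<lambda>c. inv \<sigma> c - 1) \<in> {c \<in> {1..<n}. fst (word_type n \<sigma> c)} \<rightarrow> {i \<in> {1..n-1}. \<sigma> (Suc i) < \<sigma> i}"
    proof
      fix c assume "c \<in> {c \<in> {1..<n}. fst (word_type n \<sigma> c)}"
      then have c: "1 \<le> c" "c \<le> n" "c < ext0 n \<sigma> (inv \<sigma> c - 1)"
        by (auto simp: word_type_def)
      moreover have "inv \<sigma> c - 1 \<noteq> 0" using c(3) by (auto simp: ext0_def)
      ultimately show "inv \<sigma> c - 1 \<in> {i \<in> {1..n-1}. \<sigma> (Suc i) < \<sigma> i}"
        using inv_bounds[OF \<sigma> c(1,2)] perm_inv[OF \<sigma>, of c] by (auto simp: ext0_def split: if_splits)
    qed
    show "inv \<sigma> (\<sigma> (Suc i)) - 1 = i" for i by (simp add: inv_perm[OF \<sigma>])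
    show "\<sigma> (Suc (inv \<sigma> c - 1)) = c" if "c \<in> {c \<in> {1..<n}. fst (word_type n \<sigma> c)}" for c
      using that inv_bounds[OF \<sigma>, of c] perm_inv[OF \<sigma>, of c] by auto
  qed
  then have "des n \<sigma> = card {c \<in> {1..<n}. fst (word_type n \<sigma> c)}"
    unfolding des_def by (rule bij_betw_same_card)
  then show ?thesis by (simp add: Int_def)
qed

text \<open>The letter \<open>n\<close> has no larger left neighbour, so it is never a double
  descent.\<close>

lemma dd_eq_0_iff: "dd n \<sigma> = 0 \<longleftrightarrow> (\<forall>c\<in>{1..<n}. word_type n \<sigma> c \<noteq> (True, True))"
proof -
  have ext: "ext0 n \<sigma> j = \<sigma> j" if "1 \<le> j" "j \<le> n" for j
    using that by (simp add: ext0_def)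
  have "(\<exists>i\<in>{1..n}. ext0 n \<sigma> i < ext0 n \<sigma> (i - 1) \<and> ext0 n \<sigma> (Suc i) < ext0 n \<sigma> i)
      \<longleftrightarrow> (\<exists>c\<in>{1..<n}. word_type n \<sigma> c = (True, True))"
  proof
    assume "\<exists>i\<in>{1..n}. ext0 n \<sigma> i < ext0 n \<sigma> (i - 1) \<and> ext0 n \<sigma> (Suc i) < ext0 n \<sigma> i"
    then obtain i where i: "1 \<le> i" "i \<le> n" "\<sigma> i < ext0 n \<sigma> (i - 1)" "ext0 n \<sigma> (Suc i) < \<sigma> i"
      using ext by auto
    have "\<sigma> i < n" "1 \<le> \<sigma> i"
      using i ext0_le[OF \<sigma>, of "i - 1"] perm_range[OF \<sigma>, of i] by linarith+
    then show "\<exists>c\<in>{1..<n}. word_type n \<sigma> c = (True, True)"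
      using i by (intro bexI[of _ "\<sigma> i"]) (auto simp: word_type_def inv_perm[OF \<sigma>])
  next
    assume "\<exists>c\<in>{1..<n}. word_type n \<sigma> c = (True, True)"
    then obtain c where c: "1 \<le> c" "c \<le> n" "word_type n \<sigma> c = (True, True)" by auto
    then show "\<exists>i\<in>{1..n}. ext0 n \<sigma> i < ext0 n \<sigma> (i - 1) \<and> ext0 n \<sigma> (Suc i) < ext0 n \<sigma> i"
      using inv_bounds[OF \<sigma> c(1,2)] ext[of "inv \<sigma> c"] perm_inv[OF \<sigma>, of c]
      by (intro bexI[of _ "inv \<sigma> c"]) (auto simp: word_type_def)
  qed
  then show ?thesis
    unfolding dd_def card_filter_eq_0_iff[OF finite_atLeastAtMost] by blast
qed

end

section \<open>Comparison of the weights\<close>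

lemma sum_types:
  "(\<Sum>t\<in>UNIV. F t) = F (False, False) + F (False, True) + F (True, False) + F (True, True)"
  by (simp add: UNIV_Times_UNIV[symmetric] UNIV_bool sum.cartesian_product[symmetric] add_ac
      del: UNIV_Times_UNIV)

text \<open>The induction needs all heights. Every admissible step has \<open>h + 1\<close> labels;
  Pascal's rule, applied twice, and absorption of the factor \<open>h + 1\<close> give the next
  binomial. At height 0 the down step is missing.\<close>

lemma word_count:
  "transfer (\<lambda>h t. card (word_choices h t)) m h = fact (Suc m) * (m choose h)"
proof (induction m arbitrary: h)
  case (Suc m)
  show ?case
  proof (cases h)
    case 0
    then show ?thesis by (simp add: sum_types Suc.IH algebra_simps)
  next
    case (Suc k)
    have "transfer (\<lambda>h t. card (word_choices h t)) (Suc m) h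
        = fact (Suc m) * (Suc h * ((m choose Suc h) + 2 * (m choose h) + (m choose k)))"
      by (simp add: sum_types Suc.IH Suc algebra_simps)
    also have "(m choose Suc h) + 2 * (m choose h) + (m choose k) = Suc (Suc m) choose Suc h"
      by (simp add: Suc)
    also have "Suc h * (Suc (Suc m) choose Suc h) = Suc (Suc m) * (Suc m choose h)"
      using Suc_times_binomial_eq[of "Suc m" h] by (simp only: mult.commute)
    finally show ?thesis by (simp add: algebra_simps)
  qed
qed simp

text \<open>The potential is \<open>fact h\<close>: up and down steps have \<open>h + 1\<close>
  labels each in the word coding, but 1 and \<open>h * (h + 1)\<close> in the exceedance
  coding.\<close>

lemma exc_count:
  "transfer (\<lambda>h t. card (exc_choices h t)) m 0 = fact (Suc m)"
proof -
  have "fact h * card (word_choices h t) = card (exc_choices h t) * fact (next_height h t)" for h t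
  proof -
    obtain u d where t: "t = (u, d)" by (cases t)
    show ?thesis unfolding t by (cases h; cases u; cases d) (auto simp: card_cartesian_product algebra_simps)
  qed
  then have "fact 0 * transfer (\<lambda>h t. card (word_choices h t)) m 0
      = transfer (\<lambda>h t. card (exc_choices h t)) m 0"
    by (rule transfer_gauge) simp
  then show ?thesis by (simp add: word_count)
qed

text \<open>The weight 0 removes permutations with a double descent, respectively with an index
  counted by \<open>scda\<close>; \<open>y\<close> marks descents or exceedances.\<close>

definition step_weight :: "'a::comm_semiring_1 \<Rightarrow> 'a \<Rightarrow> bool \<times> bool \<Rightarrow> nat \<Rightarrow> 'a" where
  "step_weight y q t w = (if t = (True, True) then 0 else y ^ of_bool (fst t) * q ^ w)"

lemma prod_step_weight:
  assumes "finite A"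
  shows "(\<Prod>j\<in>A. step_weight y q (t j) (w j)) =
    (if \<forall>j\<in>A. t j \<noteq> (True, True)
     then y ^ (\<Sum>j\<in>A. of_bool (fst (t j))) * q ^ (\<Sum>j\<in>A. w j) else 0)"
  using assms by (induction A rule: finite_induct) (auto simp: step_weight_def power_add algebra_simps)

text \<open>With \<open>[j]\<close> the q-integer, the word coding gives up and down steps the
  factor \<open>q^h [h+1]\<close> each. The exceedance coding gives 1 and
  \<open>q^h [h+1] q^(h-1) [h]\<close>, so the potential is the product of \<open>q^j [j+1]\<close>
  over \<open>j < h\<close>.\<close>

lemma transfer_word_eq_exc:
  fixes y q :: "'a::comm_semiring_1"
  shows "transfer (\<lambda>h t. \<Sum>x\<in>word_choices h t. step_weight y q t (h + x)) m 0
    = transfer (\<lambda>h t. \<Sum>x\<in>exc_choices h t. step_weight y q t (exc_weight h t x)) m 0"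
proof -
  define P :: "nat \<Rightarrow> 'a" where "P h = (\<Prod>j<h. q ^ j * (\<Sum>g\<le>j. q ^ g))" for h
  have "P h * (\<Sum>x\<in>word_choices h t. step_weight y q t (h + x))
      = (\<Sum>x\<in>exc_choices h t. step_weight y q t (exc_weight h t x)) * P (next_height h t)" for h t
  proof -
    have word: "(\<Sum>x\<le>h. c * q ^ (h + x)) = c * (q ^ h * (\<Sum>g\<le>h. q ^ g))" for c
      by (simp add: power_add sum_distrib_left mult.assoc)
    obtain u d where t: "t = (u, d)" by (cases t)
    consider "u" "d" | "u" "\<not> d" | "\<not> u" "\<not> d" | "\<not> u" "d" "h = 0" | k where "\<not> u" "d" "h = Suc k"
      by (cases h) auto
    then show ?thesis
    proof cases
      case 1
      then show ?thesis by (simp add: t step_weight_def)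
    next
      case 2
      then show ?thesis
        using word[of y] by (simp add: t step_weight_def P_def mult_ac)
    next
      case 3
      then show ?thesis
        using word[of 1] by (simp add: t step_weight_def sum.cartesian_product' mult_ac)
    next
      case 4
      then show ?thesis by (simp add: t)
    next
      case 5
      have "(\<Sum>x\<in>exc_choices h t. step_weight y q t (exc_weight h t x))
          = (\<Sum>r\<le>h. \<Sum>r'\<le>k. q ^ (h + r) * q ^ (k + r'))"
        using 5 by (simp add: t step_weight_def sum.cartesian_product' lessThan_Suc_atMost
            power_add mult_ac)
      also have "\<dots> = (q ^ h * (\<Sum>g\<le>h. q ^ g)) * (q ^ k * (\<Sum>g\<le>k. q ^ g))"
        unfolding sum_product[symmetric] using word[of 1] by (simp add: power_add sum_distrib_left)
      finally show ?thesis
        using 5 word[of 1] by (simp add: t step_weight_def P_def mult_ac)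
    qed
  qed
  then have "P 0 * transfer (\<lambda>h t. \<Sum>x\<in>word_choices h t. step_weight y q t (h + x)) m 0
    = transfer (\<lambda>h t. \<Sum>x\<in>exc_choices h t. step_weight y q t (exc_weight h t x)) m 0"
    by (rule transfer_gauge) (simp add: P_def)
  then show ?thesis by (simp add: P_def)
qed

section \<open>The identity in two variables and the extraction of the coefficient of
  \<open>y ^ k\<close>\<close>

lemma sum_word_eq_sum_exc:
  fixes y q :: "'a::comm_semiring_1"
  assumes n: "1 \<le> n"
  shows "(\<Sum>\<sigma>\<in>perms n. if dd n \<sigma> = 0 then y ^ des n \<sigma> * q ^ (2 * pat31_2 n \<sigma> + pat2_13 n \<sigma>) else 0)
    = (\<Sum>\<sigma>\<in>perms n. if scda n \<sigma> = 0 then y ^ exc n \<sigma> * q ^ (inversions n \<sigma> - exc n \<sigma>) else 0)"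
proof -
  have Suc_n: "Suc (n - 1) = n" using n by simp
  have "(\<Sum>\<sigma>\<in>perms n. if dd n \<sigma> = 0 then y ^ des n \<sigma> * q ^ (2 * pat31_2 n \<sigma> + pat2_13 n \<sigma>) else 0)
    = (\<Sum>\<sigma>\<in>perms n. \<Prod>c=1..<n. step_weight y q (word_type n \<sigma> c) (word_height n \<sigma> c + left_31 \<sigma> c))"
    by (intro sum.cong refl) (simp add: prod_step_weight dd_eq_0_iff des_eq_sum patterns_eq_sum[OF _ n])
  also have "\<dots> = transfer (\<lambda>h t. \<Sum>x\<in>word_choices h t. step_weight y q t (h + x)) (n - 1) 0"
  proof (rule sum_perms_eq_transfer[OF finite_word_choices n])
    show "transfer (\<lambda>h t. card (word_choices h t)) (n - 1) 0 = fact n"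
      using word_count[of "n - 1" 0] Suc_n by simp
    show "\<sigma> = \<tau>" if "\<sigma> \<in> perms n" "\<tau> \<in> perms n"
      "\<And>j. 1 \<le> j \<Longrightarrow> j < n \<Longrightarrow> word_type n \<sigma> j = word_type n \<tau> j \<and> left_31 \<sigma> j = left_31 \<tau> j" for \<sigma> \<tau>
      using word_code_inj[OF that] .
  qed (use n in \<open>auto simp: word_height_1 word_height_n left_31_mem word_height_Suc simp del: One_nat_def\<close>)
  also have "\<dots> = transfer (\<lambda>h t. \<Sum>x\<in>exc_choices h t. step_weight y q t (exc_weight h t x)) (n - 1) 0"
    by (rule transfer_word_eq_exc)
  also have "\<dots> = (\<Sum>\<sigma>\<in>perms n. \<Prod>j=1..<n. step_weight y q (exc_type \<sigma> j)
      (exc_weight (exc_height \<sigma> j) (exc_type \<sigma> j) (exc_label \<sigma> j)))"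
  proof (rule sum_perms_eq_transfer[OF finite_exc_choices n, symmetric])
    show "transfer (\<lambda>h t. card (exc_choices h t)) (n - 1) 0 = fact n"
      using exc_count[of "n - 1"] Suc_n by simp
    show "\<sigma> = \<tau>" if "\<sigma> \<in> perms n" "\<tau> \<in> perms n"
      "\<And>j. 1 \<le> j \<Longrightarrow> j < n \<Longrightarrow> exc_type \<sigma> j = exc_type \<tau> j \<and> exc_label \<sigma> j = exc_label \<tau> j" for \<sigma> \<tau>
      using exc_code_inj[OF that] .
  qed (auto simp: exc_height_1 exc_height_n exc_label_mem exc_height_Suc simp del: One_nat_def)
  also have "\<dots> = (\<Sum>\<sigma>\<in>perms n. if scda n \<sigma> = 0 then y ^ exc n \<sigma> * q ^ (inversions n \<sigma> - exc n \<sigma>) else 0)"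
  proof (rule sum.cong[OF refl])
    fix \<sigma> assume \<sigma>: "\<sigma> \<in> perms n"
    show "(\<Prod>j=1..<n. step_weight y q (exc_type \<sigma> j)
        (exc_weight (exc_height \<sigma> j) (exc_type \<sigma> j) (exc_label \<sigma> j)))
      = (if scda n \<sigma> = 0 then y ^ exc n \<sigma> * q ^ (inversions n \<sigma> - exc n \<sigma>) else 0)"
      unfolding prod_step_weight[OF finite_atLeastLessThan] scda_eq_0_iff[OF \<sigma>]
        inversions_minus_exc[OF \<sigma> n, symmetric] exc_eq_sum[OF \<sigma> n, symmetric] ..
  qed
  finally show ?thesis .
qed

text \<open>The marker is the outer variable of a polynomial ring over the polynomials in
  \<open>q\<close>, so its coefficient at \<open>k\<close> selects the permutations with statistic
  \<open>k\<close>.\<close>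

lemma coeff_marked_sum:
  assumes "finite S"
  shows "coeff (\<Sum>\<sigma>\<in>S. if P \<sigma> then monom (1::int poly) 1 ^ e \<sigma> * monom (monom 1 1) 0 ^ s \<sigma> else 0) k
    = (\<Sum>\<sigma>\<in>{\<sigma> \<in> S. e \<sigma> = k \<and> P \<sigma>}. monom 1 (s \<sigma>))"
  unfolding sum.inter_filter[OF assms] coeff_sum
  by (intro sum.cong refl) (auto simp: monom_power mult_monom)

theorem theorem2p10:
  fixes n k :: nat
  assumes "2 * k + 1 \<le> n"
  shows "(\<Sum>\<sigma>\<in>DD n k. monom (1::int) (2 * pat31_2 n \<sigma> + pat2_13 n \<sigma>))
           = (\<Sum>\<sigma>\<in>DE_star n k. monom (1::int) (inversions n \<sigma> - exc n \<sigma>))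
       \<and> (\<Sum>\<sigma>\<in>DE_star n k. monom (1::int) (inversions n \<sigma> - exc n \<sigma>))
           = (\<Sum>\<sigma>\<in>SDE n k. monom (1::int) (inversions n \<sigma> - exc n \<sigma>))"
proof -
  have n: "1 \<le> n" using assms by simp
  have "(\<Sum>\<sigma>\<in>DD n k. monom (1::int) (2 * pat31_2 n \<sigma> + pat2_13 n \<sigma>))
      = (\<Sum>\<sigma>\<in>SDE n k. monom (1::int) (inversions n \<sigma> - exc n \<sigma>))"
    \<comment> \<open>Here \<open>y\<close> is the outer variable, and \<open>q\<close> is the inner
      variable as a constant polynomial.\<close>
    using arg_cong[OF sum_word_eq_sum_exc[OF n, of "monom (1::int poly) 1" "monom (monom 1 1) 0"],
        of "\<lambda>p. coeff p k"]
    unfolding coeff_marked_sum[OF finite_perms] DD_def SDE_def .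
  then show ?thesis by (simp add: DE_star_eq_SDE)
qed

end
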